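(* Let $\mathcal{C}=(C_1,\dots,C_m)$, $m\ge 2$, be a collection of $m$ pinhole cameras with distinct centers. Then $$\mathcal{L}_{\mathcal{C}} = \left\{\ell \in (\mathbb P^2)^m \mid \mathrm{rank}\, M(\ell) \leq 2\right\}\cap \mathcal Y_\mathcal{C}.$$
   Context: All projective spaces are complex. A pinhole camera is a full-rank matrix $C\in\mathbb C^{3\times 4}$; its center is the point $c=\ker(C)\in\mathbb P^3$. Let $\mathbb G$ be the Grassmannian of lines in $\mathbb P^3$. A line in $\mathbb P^2$ is identified with its linear equation $\ell\in\mathbb P^2$: a point $x$ is on the line if and only if $x^T\ell=0$. For a line $L\subset\mathbb P^3$ through points $x,y$ and not through the center of $C$, $C\cdot L$ denotes the line in $\mathbb P^2$ through $Cx$ and $Cy$. The joint camera map is the rational map $\Upsilon_{\mathcal C}:\mathbb G\dashrightarrow(\mathbb P^2)^m$, $L\mapsto (C_1\cdot L,\dots,C_m\cdot L)$, defined at the lines that pass through no camera center $c_i=\ker(C_i)$; $\Upsilon_{\mathcal C}(\mathbb G)$ denotes its image. The line multiview variety is the Zariski closure $\mathcal L_{\mathcal C}:=\overline{\Upsilon_{\mathcal C}(\mathbb G)}\subseteq(\mathbb P^2)^m$. For $\ell=(\ell_1,\dots,\ell_m)\in(\mathbb P^2)^m$, $M(\ell)=\begin{bmatrix}C_1^T\ell_1&\cdots&C_m^T\ell_m\end{bmatrix}\in\mathbb C^{4\times m}$, and the back-projected planes are $H_i=\{p\in\mathbb P^3\mid p^TC_i^T\ell_i=0\}$. For $I\subseteq\{1,\dots,m\}$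 with $|I|\ge2$ let $E_I:=\operatorname{span}\{c_i\mid i\in I\}\subseteq\mathbb P^3$. If $E_I$ is a line, let $E_I^*:=\{p\in\mathbb P^3\mid p^*q=0\text{ for all }q\in E_I\}$ ($p^*$ the conjugate transpose), which is a line disjoint from $E_I$. For $i\in I$ let $F_I(\ell_i):=\operatorname{span}\big(\{c_i\}\cup(H_i\cap E_I^* )\big)$ (a line if $E_I^*\not\subseteq H_i$, and otherwise the plane spanned by $c_i$ and $E_I^*$), and $\Omega_I(\ell_i):=\{L\in\mathbb G\mid L\cap F_I(\ell_i)\ne\emptyset\}$. Define $$\mathcal Y_{\mathcal C,I}:=\Big\{\ell\in(\mathbb P^2)^m\ \Big|\ \dim\bigcap_{i\in I}\Omega_I(\ell_i)\ge1\Big\},\qquad \mathcal Y_{\mathcal C}:=\bigcap_{I\subseteq\{1,\dots,m\}:\ E_I\text{ is a line}}\mathcal Y_{\mathcal C,I}.$$ *)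

theory Defs
  imports "HOL-Analysis.Analysis"
begin

section \<open>Complex projective space\<close>

definition proj_rel :: "complex ^ 'n \<Rightarrow> complex ^ 'n \<Rightarrow> bool" where
  "proj_rel x y \<longleftrightarrow> x \<noteq> 0 \<and> y \<noteq> 0 \<and> (\<exists>a. a \<noteq> 0 \<and> y = a *s x)"

lemma part_equivp_proj_rel: "part_equivp proj_rel"
proof (rule part_equivpI)
  have "proj_rel (1 :: complex ^ 'n) 1"
    unfolding proj_rel_def by (auto intro!: exI[of _ 1])
  then show "\<exists>x :: complex ^ 'n. proj_rel x x" by blast
  show "symp (proj_rel :: complex ^ 'n \<Rightarrow> _)"
  proof (rule sympI)
    fix x y :: "complex ^ 'n"
    assume "proj_rel x y"
    then obtain a where a: "x \<noteq> 0" "y \<noteq> 0" "a \<noteq> 0" "y = a *s x"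
      unfolding proj_rel_def by blast
    then have "x = inverse a *s y"
      by (simp add: vector_smult_assoc)
    with a show "proj_rel y x"
      unfolding proj_rel_def by (metis nonzero_imp_inverse_nonzero)
  qed
  show "transp (proj_rel :: complex ^ 'n \<Rightarrow> _)"
    by (rule transpI, unfold proj_rel_def) (metis mult_eq_0_iff vector_smult_assoc)
qed

text \<open>
  The projective space of \<open>complex ^ 'n\<close>, of dimension \<open>CARD('n) - 1\<close>; so \<open>3 proj\<close> and
  \<open>4 proj\<close> are the complex projective plane and 3-space.  The function \<open>rep_proj\<close> chooses
  homogeneous coordinates of a point; everything below is independent of this choice.
\<close>

quotient_type (overloaded) 'n proj = "complex ^ 'n::finite" / partial: proj_rel
  by (rule part_equivp_proj_rel)

lemma rep_proj_nonzero: "rep_proj p \<noteq> 0"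
  by (metis Quotient3_proj Quotient3_rep_reflp proj_rel_def)

lemma rep_proj_abs_proj:
  assumes "x \<noteq> 0"
  shows "\<exists>a. a \<noteq> 0 \<and> rep_proj (abs_proj x) = a *s x"
proof -
  have "proj_rel x x"
    using assms unfolding proj_rel_def by (auto intro!: exI[of _ 1])
  then have "proj_rel x (rep_proj (abs_proj x))"
    by (metis Quotient3_proj rep_abs_rsp)
  then show ?thesis
    unfolding proj_rel_def by blast
qed

definition proj_span :: "'n::finite proj set \<Rightarrow> 'n proj set" where
  "proj_span S = {p. rep_proj p \<in> vec.span (rep_proj ` S)}"

definition is_line :: "'n::finite proj set \<Rightarrow> bool" where
  "is_line L \<longleftrightarrow> (\<exists>x y. x \<noteq> y \<and> L = proj_span {x, y})"


section \<open>Zariski topologies and dimension\<close>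

text \<open>
  A polynomial function in the coordinates \<open>x i $ j\<close> that is homogeneous of degree \<open>d i\<close> in
  the \<open>i\<close>-th group of coordinates, for every \<open>i\<close>.
\<close>

definition multihomogeneous :: "('m::finite \<Rightarrow> nat) \<Rightarrow> (('m \<Rightarrow> complex ^ 'n::finite) \<Rightarrow> complex) \<Rightarrow> bool" where
  "multihomogeneous d f \<longleftrightarrow> (\<exists>A c. finite A \<and> (\<forall>\<alpha>\<in>A. \<forall>i. (\<Sum>j\<in>UNIV. \<alpha> i j) = d i) \<and>
     f = (\<lambda>x. \<Sum>\<alpha>\<in>A. c \<alpha> * (\<Prod>i\<in>UNIV. \<Prod>j\<in>UNIV. x i $ j ^ \<alpha> i j)))"

definition distinguished_open :: "(('m \<Rightarrow> complex ^ 'n::finite) \<Rightarrow> complex) \<Rightarrow> ('m \<Rightarrow> 'n proj) set" where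
  "distinguished_open f = {p. f (\<lambda>i. rep_proj (p i)) \<noteq> 0}"

text \<open>
  The Zariski topology of a product of projective spaces (not the product of the Zariski
  topologies).  The distinguished open sets form a base of it; \<open>zariski_closure_of\<close> below gives
  the description by vanishing polynomials.
\<close>

definition zariski :: "('m::finite \<Rightarrow> 'n::finite proj) topology" where
  "zariski = topology_generated_by {distinguished_open f | f d. multihomogeneous d f}"

lemma multihomogeneous_const: "multihomogeneous (\<lambda>_. 0) (\<lambda>_. a)"
  unfolding multihomogeneous_def
  by (intro exI[of _ "{\<lambda>_ _. 0}"] exI[of _ "\<lambda>_. a"]) simp

lemma multihomogeneous_mult:
  fixes f g :: "('m::finite \<Rightarrow> complex ^ 'n::finite) \<Rightarrow> complex"
  assumes "multihomogeneous d f" "multihomogeneous e g"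
  shows "multihomogeneous (\<lambda>i. d i + e i) (\<lambda>x. f x * g x)"
proof -
  define mon :: "('m \<Rightarrow> complex ^ 'n) \<Rightarrow> ('m \<Rightarrow> 'n \<Rightarrow> nat) \<Rightarrow> complex"
    where "mon x \<alpha> = (\<Prod>i\<in>UNIV. \<Prod>j\<in>UNIV. x i $ j ^ \<alpha> i j)" for x \<alpha>
  obtain A a where A: "finite A" "\<forall>\<alpha>\<in>A. \<forall>i. (\<Sum>j\<in>UNIV. \<alpha> i j) = d i"
    "f = (\<lambda>x. \<Sum>\<alpha>\<in>A. a \<alpha> * mon x \<alpha>)"
    using assms(1) unfolding multihomogeneous_def mon_def by blast
  obtain B b where B: "finite B" "\<forall>\<alpha>\<in>B. \<forall>i. (\<Sum>j\<in>UNIV. \<alpha> i j) = e i"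
    "g = (\<lambda>x. \<Sum>\<alpha>\<in>B. b \<alpha> * mon x \<alpha>)"
    using assms(2) unfolding multihomogeneous_def mon_def by blast
  define s :: "('m \<Rightarrow> 'n \<Rightarrow> nat) \<times> ('m \<Rightarrow> 'n \<Rightarrow> nat) \<Rightarrow> 'm \<Rightarrow> 'n \<Rightarrow> nat"
    where "s = (\<lambda>(\<alpha>, \<beta>) i j. \<alpha> i j + \<beta> i j)"
  define c where "c \<gamma> = (\<Sum>q\<in>{q \<in> A \<times> B. s q = \<gamma>}. a (fst q) * b (snd q))" for \<gamma>
  have mon_s: "mon x (s q) = mon x (fst q) * mon x (snd q)" for x q
    by (cases q) (simp add: mon_def s_def power_add prod.distrib)
  have "f x * g x = (\<Sum>\<gamma>\<in>s ` (A \<times> B). c \<gamma> * mon x \<gamma>)" for x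
  proof -
    have "f x * g x = (\<Sum>q\<in>A \<times> B. a (fst q) * b (snd q) * mon x (s q))"
      unfolding A(3) B(3) mon_s
      by (simp add: sum_product sum.cartesian_product case_prod_beta mult_ac)
    also have "\<dots> = (\<Sum>\<gamma>\<in>s ` (A \<times> B). \<Sum>q\<in>{q \<in> A \<times> B. s q = \<gamma>}. a (fst q) * b (snd q) * mon x (s q))"
      by (rule sum.image_gen) (use A B in simp)
    also have "\<dots> = (\<Sum>\<gamma>\<in>s ` (A \<times> B). c \<gamma> * mon x \<gamma>)"
      by (intro sum.cong refl) (simp add: c_def sum_distrib_right)
    finally show ?thesis .
  qed
  moreover have "\<forall>\<gamma>\<in>s ` (A \<times> B). \<forall>i. (\<Sum>j\<in>UNIV. \<gamma> i j) = d i + e i"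
    using A(2) B(2) by (auto simp: s_def sum.distrib)
  ultimately show ?thesis
    unfolding multihomogeneous_def mon_def using A(1) B(1)
    by (intro exI[of _ "s ` (A \<times> B)"] exI[of _ c]) auto
qed

lemma distinguished_open_mult:
  "distinguished_open f \<inter> distinguished_open g = distinguished_open (\<lambda>x. f x * g x)"
  by (auto simp: distinguished_open_def)

lemma openin_zariski_base:
  assumes "openin zariski U" "p \<in> U"
  shows "\<exists>f d. multihomogeneous d f \<and> p \<in> distinguished_open f \<and> distinguished_open f \<subseteq> U"
proof -
  have "generate_topology_on {distinguished_open f | f d. multihomogeneous d f} U"
    using assms(1) unfolding zariski_def by (rule openin_topology_generated_by)
  then show ?thesis
    using assms(2)
  proof (induction arbitrary: p)
    case Empty
    then show ?case by simp
  next
    case (Int U V)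
    then obtain f d g e where
      "multihomogeneous d f" "p \<in> distinguished_open f" "distinguished_open f \<subseteq> U"
      "multihomogeneous e g" "p \<in> distinguished_open g" "distinguished_open g \<subseteq> V"
      by (meson IntD1 IntD2)
    then show ?case
      using multihomogeneous_mult[of d f e g] distinguished_open_mult[of f g] by blast
  next
    case (UN K)
    then show ?case by (meson UnionE Union_upper order_trans)
  next
    case (Basis s)
    then show ?case by blast
  qed
qed

lemma topspace_zariski: "topspace zariski = UNIV"
proof -
  have "distinguished_open (\<lambda>_. 1) = UNIV"
    by (simp add: distinguished_open_def)
  then have "UNIV \<in> {distinguished_open f | f d. multihomogeneous d f}"
    using multihomogeneous_const[of 1] by force
  then show ?thesis
    unfolding zariski_def topology_generated_by_topspace by blast
qed

lemma zariski_closure_of: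
  fixes S :: "('m::finite \<Rightarrow> 'n::finite proj) set"
  shows "zariski closure_of S =
    {p. \<forall>f d. multihomogeneous d f \<longrightarrow> (\<forall>q\<in>S. f (\<lambda>i. rep_proj (q i)) = 0) \<longrightarrow> f (\<lambda>i. rep_proj (p i)) = 0}"
proof -
  have op: "openin zariski (distinguished_open f)" if "multihomogeneous d f"
    for d and f :: "('m \<Rightarrow> complex ^ 'n) \<Rightarrow> complex"
    unfolding zariski_def by (rule topology_generated_by_Basis) (use that in blast)
  have "p \<in> zariski closure_of S \<longleftrightarrow> (\<forall>f d. multihomogeneous d f \<longrightarrow>
      p \<in> distinguished_open f \<longrightarrow> (\<exists>q\<in>S. q \<in> distinguished_open f))" (is "?l \<longleftrightarrow> ?r") for p
  proof
    assume ?l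
    then show ?r
      using op unfolding in_closure_of by blast
  next
    assume r: ?r
    have "\<exists>q\<in>S. q \<in> U" if U: "openin zariski U" "p \<in> U" for U
    proof -
      obtain f d where "multihomogeneous d f" "p \<in> distinguished_open f" "distinguished_open f \<subseteq> U"
        using openin_zariski_base[OF U] by blast
      with r show ?thesis by blast
    qed
    then show ?l
      unfolding in_closure_of topspace_zariski by blast
  qed
  then show ?thesis
    unfolding distinguished_open_def by blast
qed

definition irreducible_closedin :: "'a topology \<Rightarrow> 'a set \<Rightarrow> bool" where
  "irreducible_closedin T Z \<longleftrightarrow> closedin T Z \<and> Z \<noteq> {} \<and>
     (\<forall>A B. closedin T A \<longrightarrow> closedin T B \<longrightarrow> Z = A \<union> B \<longrightarrow> A = Z \<or> B = Z)"

text \<open>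
  The supremum of the lengths of chains of irreducible closed subsets.  It is taken in
  \<open>ereal\<close>, so that the empty space has dimension \<open>-\<infinity>\<close>.
\<close>

definition krull_dim :: "'a topology \<Rightarrow> ereal" where
  "krull_dim T = Sup {ereal (real n) | n. \<exists>Z :: nat \<Rightarrow> 'a set.
     (\<forall>i\<le>n. irreducible_closedin T (Z i)) \<and> (\<forall>i<n. Z i \<subset> Z (Suc i))}"


section \<open>The Grassmannian of lines in 3-space\<close>

definition grass :: "4 proj set set" where
  "grass = {L. is_line L}"

text \<open>
  All sixteen coordinates \<open>x\<^sub>i y\<^sub>j - x\<^sub>j y\<^sub>i\<close> are kept instead of the six with \<open>i < j\<close>; the
  redundant ones are zero or the negative of another one.
\<close>

definition pluecker :: "4 proj set \<Rightarrow> (4 \<times> 4) proj" where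
  "pluecker L = (THE q. \<exists>x\<in>L. \<exists>y\<in>L. x \<noteq> y \<and>
     q = abs_proj (vec_lambda (\<lambda>(i, j).
       rep_proj x $ i * rep_proj y $ j - rep_proj x $ j * rep_proj y $ i)))"

text \<open>
  The Zariski topology induced by the Pluecker embedding; a projective space is regarded as a
  product with one factor, indexed by the one-element type \<open>1\<close>.
\<close>

definition grass_zariski :: "4 proj set topology" where
  "grass_zariski = pullback_topology grass (\<lambda>L (_ :: 1). pluecker L) zariski"


section \<open>Cameras and line multiview varieties\<close>

definition pinhole_camera :: "complex ^ 4 ^ 3 \<Rightarrow> bool" where
  "pinhole_camera C \<longleftrightarrow> rank C = 3"

definition center :: "complex ^ 4 ^ 3 \<Rightarrow> 4 proj" where
  "center C = (THE c. C *v rep_proj c = 0)"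

definition cam_point :: "complex ^ 4 ^ 3 \<Rightarrow> 4 proj \<Rightarrow> 3 proj" where
  "cam_point C x = abs_proj (C *v rep_proj x)"

definition line_of_equation :: "3 proj \<Rightarrow> 3 proj set" where
  "line_of_equation l = {x. scalar_product (rep_proj x) (rep_proj l) = 0}"

text \<open>
  Meaningful only for lines \<open>L\<close> that avoid the center of \<open>C\<close>, as is \<open>cam_point\<close> only for points
  other than the center.
\<close>

definition cam_line :: "complex ^ 4 ^ 3 \<Rightarrow> 4 proj set \<Rightarrow> 3 proj" where
  "cam_line C L = (THE l. \<exists>x\<in>L. \<exists>y\<in>L. x \<noteq> y \<and>
     line_of_equation l = proj_span {cam_point C x, cam_point C y})"

definition joint_camera_map :: "('m \<Rightarrow> complex ^ 4 ^ 3) \<Rightarrow> 4 proj set \<Rightarrow> 'm \<Rightarrow> 3 proj" where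
  "joint_camera_map C L = (\<lambda>i. cam_line (C i) L)"

definition joint_camera_image :: "('m \<Rightarrow> complex ^ 4 ^ 3) \<Rightarrow> ('m \<Rightarrow> 3 proj) set" where
  "joint_camera_image C = joint_camera_map C ` {L \<in> grass. \<forall>i. center (C i) \<notin> L}"

definition line_multiview_variety :: "('m::finite \<Rightarrow> complex ^ 4 ^ 3) \<Rightarrow> ('m \<Rightarrow> 3 proj) set" where
  "line_multiview_variety C = zariski closure_of joint_camera_image C"

text \<open>
  The columns depend on the chosen coordinates of the \<open>l i\<close> by nonzero factors only, which do
  not affect the rank.
\<close>

definition M_matrix :: "('m \<Rightarrow> complex ^ 4 ^ 3) \<Rightarrow> ('m \<Rightarrow> 3 proj) \<Rightarrow> complex ^ 'm ^ 4" where
  "M_matrix C l = (\<chi> r i. (transpose (C i) *v rep_proj (l i)) $ r)"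

definition back_plane :: "complex ^ 4 ^ 3 \<Rightarrow> 3 proj \<Rightarrow> 4 proj set" where
  "back_plane C l = {p. scalar_product (rep_proj p) (transpose C *v rep_proj l) = 0}"

definition center_span :: "('m \<Rightarrow> complex ^ 4 ^ 3) \<Rightarrow> 'm set \<Rightarrow> 4 proj set" where
  "center_span C I = proj_span ((\<lambda>i. center (C i)) ` I)"

definition conj_dual :: "4 proj set \<Rightarrow> 4 proj set" where
  "conj_dual E = {p. \<forall>q\<in>E. scalar_product (\<chi> i. cnj (rep_proj p $ i)) (rep_proj q) = 0}"

text \<open>In \<open>F_space\<close> and \<open>Omega\<close>, \<open>l\<close> is the single image line \<open>\<ell>\<^sub>i\<close> of the camera \<open>i \<in> I\<close>.\<close>

definition F_space :: "('m \<Rightarrow> complex ^ 4 ^ 3) \<Rightarrow> 'm set \<Rightarrow> 'm \<Rightarrow> 3 proj \<Rightarrow> 4 proj set" where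
  "F_space C I i l =
     proj_span ({center (C i)} \<union> (back_plane (C i) l \<inter> conj_dual (center_span C I)))"

definition Omega :: "('m \<Rightarrow> complex ^ 4 ^ 3) \<Rightarrow> 'm set \<Rightarrow> 'm \<Rightarrow> 3 proj \<Rightarrow> 4 proj set set" where
  "Omega C I i l = {L \<in> grass. L \<inter> F_space C I i l \<noteq> {}}"

definition Y_set :: "('m \<Rightarrow> complex ^ 4 ^ 3) \<Rightarrow> 'm set \<Rightarrow> ('m \<Rightarrow> 3 proj) set" where
  "Y_set C I = {l. krull_dim (subtopology grass_zariski (\<Inter>i\<in>I. Omega C I i (l i))) \<ge> 1}"

definition Y_variety :: "('m \<Rightarrow> complex ^ 4 ^ 3) \<Rightarrow> ('m \<Rightarrow> 3 proj) set" where
  "Y_variety C = (\<Inter>I\<in>{I. card I \<ge> 2 \<and> is_line (center_span C I)}. Y_set C I)"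

end

theory Submission
  imports Defs
begin

text \<open>
  Write \<open>h\<^sub>i = C\<^sub>i\<^sup>T \<ell>\<^sub>i\<close> for the covector of the back-projected plane \<open>H\<^sub>i\<close> and \<open>c\<^sub>i\<close> for a vector
  spanning the kernel of \<open>C\<^sub>i\<close>.  A tuple \<open>\<ell>\<close> lies in the image of the joint camera map iff some
  line that avoids all centers is contained in all the planes \<open>H\<^sub>i\<close> (lemma
  \<open>joint_camera_image_iff\<close>).

  The key to \<open>\<Y>\<^sub>C\<close> is a linear reformulation.  Let \<open>I\<close> be a set of cameras with collinear
  centers, \<open>E\<close> the 2-dimensional space spanned by these centers, and \<open>W\<close> its Hermitian
  complement.  The lines \<open>E\<close> and \<open>W\<close> meet every \<open>F\<^sub>I(\<ell>\<^sub>i)\<close>.  Call a nonzero linear map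
  \<open>\<phi> : E \<rightarrow> W\<close> compatible with \<open>\<ell>\<close> on \<open>I\<close> if \<open>h\<^sub>i \<phi>(c\<^sub>i) = 0\<close> for all \<open>i \<in> I\<close>.  A third line
  that meets all \<open>F\<^sub>I(\<ell>\<^sub>i)\<close> gives a compatible map: if it is disjoint from \<open>W\<close>, it is the graph of
  one; if it meets \<open>W\<close> in a point \<open>z\<close>, a map of rank one with image \<open>z\<close> is compatible
  (\<open>third_transversal\<close>).  Conversely the graphs of the maps \<open>t\<phi>\<close>, for a compatible \<open>\<phi>\<close>, form
  a pencil of common transversals (\<open>graph_pencil\<close>).  As two points form a set of dimension zero,
  \<open>\<ell> \<in> \<Y>\<^sub>C\<^sub>,\<^sub>I\<close> means exactly that a compatible map exists.  This is a system of \<open>|I|\<close> linear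
  equations in the four coefficients of \<open>\<phi>\<close>, so it is expressed by the vanishing of
  \<open>4\<times>4\<close> determinants, which are multihomogeneous in \<open>\<ell>\<close> (\<open>common_orthogonal_closed\<close>).

  This gives the inclusion of the line multiview variety: the conditions are closed, and they
  hold on the image because a line \<open>L\<close> contained in all \<open>H\<^sub>i\<close> meets each \<open>F\<^sub>I(\<ell>\<^sub>i)\<close>, as two lines
  in the plane \<open>H\<^sub>i\<close> meet; thus \<open>L\<close> is itself a third transversal, unless \<open>L = W\<close>, where
  every \<open>\<phi>\<close> is compatible.  The condition on the rank is treated in the same way.

  For the other inclusion, \<open>rank M(\<ell>) \<le> 2\<close> provides a 2-dimensional space \<open>E\<close> contained in all
  \<open>H\<^sub>i\<close>.  Let \<open>J\<close> be the set of the cameras with center in \<open>E\<close>.  If \<open>|J| \<ge> 2\<close>, then \<open>E\<close> is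
  the line spanned by these centers and \<open>\<Y>\<^sub>C\<^sub>,\<^sub>J\<close> provides a compatible map \<open>\<phi>\<close> on \<open>J\<close>; if
  \<open>|J| \<le> 1\<close>, there is one trivially.  If \<open>\<phi>(c\<^sub>i) \<noteq> 0\<close> for all \<open>i \<in> J\<close>, then the graph of \<open>t\<phi>\<close>
  avoids all centers for general \<open>t\<close>, and its image tends to \<open>\<ell>\<close> for \<open>t \<rightarrow> 0\<close>
  (\<open>closure_if_transversal_deformation\<close>).  Otherwise \<open>\<phi>\<close> kills exactly one center \<open>c\<^sub>j\<close>, since the
  centers are distinct; then a first-order change of \<open>\<phi>\<close> reduces to the former case
  (\<open>closure_if_degenerate_deformation\<close>).
\<close>

section \<open>Bilinear orthogonality and rank\<close>

lemma scalar_product_add: "scalar_product (x + y) z = scalar_product x z + scalar_product y z"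
  "scalar_product z (x + y) = scalar_product z x + scalar_product z y"
  for x y z :: "complex ^ 'n"
  by (simp_all add: scalar_product_def algebra_simps sum.distrib)

lemma scalar_product_diff: "scalar_product (x - y) z = scalar_product x z - scalar_product y z"
  "scalar_product z (x - y) = scalar_product z x - scalar_product z y"
  for x y z :: "complex ^ 'n"
  by (simp_all add: scalar_product_def algebra_simps sum_subtractf)

lemma scalar_product_smult: "scalar_product (a *s x) z = a * scalar_product x z"
  "scalar_product z (a *s x) = a * scalar_product z x"
  for x z :: "complex ^ 'n"
  by (simp_all add: scalar_product_def algebra_simps sum_distrib_left)

lemma scalar_product_zero [simp]: "scalar_product 0 z = 0" "scalar_product z 0 = 0"
  for z :: "complex ^ 'n"
  by (simp_all add: scalar_product_def)

lemmas scalar_product_simps = scalar_product_add scalar_product_diff scalar_product_smult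

lemma scalar_product_commute: "scalar_product x y = scalar_product y x"
  for x y :: "complex ^ 'n"
  by (simp add: scalar_product_def mult.commute)

lemma scalar_product_axis: "scalar_product x (axis k 1) = x $ k"
  for x :: "complex ^ 'n"
  by (simp add: scalar_product_def axis_def if_distrib cong: if_cong)

lemma scalar_product_matrix: "scalar_product x (A *v y) = scalar_product (transpose A *v x) y"
  for x :: "complex ^ 'n" and y :: "complex ^ 'm"
  unfolding scalar_product_def matrix_vector_mult_def transpose_def
  by (simp add: sum_distrib_left sum_distrib_right mult_ac) (subst sum.swap, simp)

lemma in_span_2: "x \<in> vec.span {u, v} \<longleftrightarrow> (\<exists>a b. x = a *s u + b *s v)"
  for x :: "complex ^ 'n"
proof -
  have "x \<in> vec.span {u, v} \<longleftrightarrow> (\<exists>a b. x - a *s u = b *s v)"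
    by (auto simp: vec.span_breakdown_eq[of x u] vec.span_singleton)
  then show ?thesis by (simp add: algebra_simps)
qed

lemma scalar_product_span_zero:
  assumes "\<forall>s\<in>S. scalar_product s x = 0" "y \<in> vec.span S"
  shows "scalar_product y x = (0 :: complex)"
  using assms(2)
  by (induction rule: vec.span_induct_alt) (use assms(1) in \<open>auto simp: scalar_product_simps\<close>)

lemma scalar_product_all_zero:
  assumes "\<And>y. scalar_product x y = 0"
  shows "x = (0 :: complex ^ 'n)"
  using assms[of "axis _ 1"] by (simp add: scalar_product_axis vec_eq_iff)

text \<open>
  A vector outside the span of \<open>S\<close> extends a basis of this span to an independent set, so some
  linear map kills \<open>S\<close> but not this vector; a suitable row of its matrix is orthogonal to \<open>S\<close>.
\<close>

lemma exists_orthogonal: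
  fixes S :: "(complex ^ 'n) set"
  assumes "vec.dim S < CARD('n)"
  shows "\<exists>x. x \<noteq> 0 \<and> (\<forall>s\<in>S. scalar_product s x = 0)"
proof -
  have "vec.span S \<noteq> UNIV"
    using assms vec.dim_eq_full[of S] by (simp add: vec.dimension_def card_cart_basis)
  then obtain v where v: "v \<notin> vec.span S" by blast
  obtain B where B: "B \<subseteq> S" "vec.independent B" "S \<subseteq> vec.span B"
    by (rule vec.basis_exists)
  have vB: "v \<notin> vec.span B"
    using v B(1) vec.span_mono by blast
  then have "vec.independent (insert v B)"
    using B(2) by (rule vec.independent_insertI)
  then obtain g where g: "Vector_Spaces.linear (*s) (*s) g" "\<forall>x\<in>insert v B. g x = (if x = v then v else 0)"
    using vec.linear_independent_extend[of "insert v B" "\<lambda>x. if x = v then v else 0"] by blast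
  have "v \<noteq> 0" using v vec.span_zero by blast
  then obtain i where i: "v $ i \<noteq> 0" by (auto simp: vec_eq_iff)
  define x where "x = row i (matrix g)"
  have x: "scalar_product y x = g y $ i" for y
  proof -
    have "g y = matrix g *v y" using matrix_works[OF g(1)] by simp
    then show ?thesis
      by (simp add: x_def row_def scalar_product_def matrix_vector_mult_def mult.commute)
  qed
  have "\<forall>s\<in>B. scalar_product s x = 0"
    using g(2) vB by (auto simp: x vec.span_base)
  then have "\<forall>s\<in>S. scalar_product s x = 0"
    using scalar_product_span_zero B(3) by blast
  moreover have "x \<noteq> 0"
    using x[of v] g(2) i by auto
  ultimately show ?thesis by blast
qed

lemma orthogonal_unique:
  fixes S :: "(complex ^ 'n) set"
  assumes "CARD('n) \<le> vec.dim S + 1" "x \<noteq> 0"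
    and "\<forall>s\<in>S. scalar_product s x = 0" "\<forall>s\<in>S. scalar_product s y = 0"
  shows "\<exists>a. y = a *s x"
proof -
  obtain d where d: "scalar_product d x \<noteq> 0"
    using scalar_product_all_zero[of x] assms(2) by (metis scalar_product_commute)
  then have "d \<notin> vec.span S"
    using scalar_product_span_zero[OF assms(3)] by blast
  then have "vec.dim (insert d S) = vec.dim S + 1"
    by (simp add: vec.dim_insert)
  then have full: "vec.span (insert d S) = UNIV"
    using assms(1) vec.dim_subset_UNIV[of "insert d S"] vec.dim_eq_full[of "insert d S"]
    by (simp add: vec.dimension_def card_cart_basis)
  define a where "a = scalar_product d y / scalar_product d x"
  have "\<forall>s\<in>insert d S. scalar_product s (y - a *s x) = 0"
    using assms(3,4) d by (simp add: scalar_product_simps a_def)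
  then have "scalar_product z (y - a *s x) = 0" for z
    using scalar_product_span_zero full by blast
  then have "y - a *s x = 0"
    using scalar_product_all_zero scalar_product_commute by metis
  then show ?thesis by auto
qed

definition indep2 :: "complex ^ 'n \<Rightarrow> complex ^ 'n \<Rightarrow> bool" where
  "indep2 u v \<longleftrightarrow> (\<forall>a b. a *s u + b *s v = 0 \<longrightarrow> a = 0 \<and> b = 0)"

lemma indep2_nonzero: "indep2 u v \<Longrightarrow> u \<noteq> 0" "indep2 u v \<Longrightarrow> v \<noteq> 0"
  unfolding indep2_def
  by (metis add.right_neutral vec.scale_zero_right vec.scale_zero_left zero_neq_one)+

lemma indep2_iff: "indep2 u v \<longleftrightarrow> u \<noteq> 0 \<and> (\<forall>a. v \<noteq> a *s u)"
proof
  assume l: "indep2 u v"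
  have "v \<noteq> a *s u" for a
  proof
    assume "v = a *s u"
    then have "(- a) *s u + 1 *s v = 0" by simp
    then show False using l unfolding indep2_def by (metis zero_neq_one)
  qed
  then show "u \<noteq> 0 \<and> (\<forall>a. v \<noteq> a *s u)" using indep2_nonzero l by blast
next
  assume r: "u \<noteq> 0 \<and> (\<forall>a. v \<noteq> a *s u)"
  show "indep2 u v" unfolding indep2_def
  proof (intro allI impI)
    fix a b assume 0: "a *s u + b *s v = 0"
    have "b = 0"
    proof (rule ccontr)
      assume b: "b \<noteq> 0"
      then have "v = (- a / b) *s u"
      proof -
        have "b *s v = (- a) *s u" using 0 by (simp add: eq_neg_iff_add_eq_0 add.commute)
        then have "inverse b *s (b *s v) = inverse b *s ((- a) *s u)" by simp
        then show ?thesis using b by (simp add: vector_smult_assoc field_simps)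
      qed
      with r show False by blast
    qed
    then show "a = 0 \<and> b = 0" using 0 r by simp
  qed
qed

lemma dim_2_iff: "vec.dim {u, v} = 2 \<longleftrightarrow> indep2 u v"
  for u v :: "complex ^ 'n"
proof -
  have "vec.dim {u, v} = (if v \<in> vec.span {u} then vec.dim {u} else vec.dim {u} + 1)"
    using vec.dim_insert[of v "{u}"] by (simp add: insert_commute)
  then show ?thesis
    by (auto simp: indep2_iff vec.span_singleton)
qed

text \<open>
  Express each row in a basis \<open>B\<close> of the row space; then the columns are combinations of the
  \<open>card B\<close> coefficient vectors.  Applied also to the transpose, this shows that row rank and
  column rank agree over the complex numbers.
\<close>

lemma dim_columns_le_dim_rows:
  fixes A :: "complex ^ 'n ^ 'm"
  shows "vec.dim (columns A) \<le> vec.dim (rows A)"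
proof -
  obtain B where B: "vec.independent B" "rows A \<subseteq> vec.span B" "card B = vec.dim (rows A)"
    by (rule vec.basis_exists)
  have fin: "finite B" using B(1) by (rule vec.finiteI_independent)
  have "\<exists>u. row r A = (\<Sum>b\<in>B. u b *s b)" for r
    using B(2) by (auto simp: vec.span_finite[OF fin] rows_def)
  then obtain u where u: "row r A = (\<Sum>b\<in>B. u r b *s b)" for r by metis
  have "column i A \<in> vec.span ((\<lambda>b. \<chi> r. u r b) ` B)" for i
  proof -
    have "A $ r $ i = (\<Sum>b\<in>B. u r b * b $ i)" for r
      using arg_cong[OF u[of r], of "\<lambda>x. x $ i"] by (simp add: row_def)
    then have "column i A = (\<Sum>b\<in>B. b $ i *s (\<chi> r. u r b))"
      by (simp add: vec_eq_iff column_def mult.commute)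
    then show ?thesis
      by (simp add: vec.span_sum vec.span_scale vec.span_base)
  qed
  then have "columns A \<subseteq> vec.span ((\<lambda>b. \<chi> r. u r b) ` B)"
    by (auto simp: columns_def)
  then have "vec.dim (columns A) \<le> card ((\<lambda>b. (\<chi> r. u r b) :: complex ^ 'm) ` B)"
    using fin by (intro vec.dim_le_card) auto
  also have "\<dots> \<le> card B" using fin by (rule card_image_le)
  finally show ?thesis using B(3) by simp
qed

lemma rank_eq_dim_columns: "rank A = vec.dim (columns A)"
  for A :: "complex ^ 'n ^ 'm"
  using dim_columns_le_dim_rows[of A] dim_columns_le_dim_rows[of "transpose A"]
  by (simp add: row_rank_def_gen)

section \<open>Volume forms in dimension four\<close>

definition minor3 :: "complex ^ 4 \<Rightarrow> complex ^ 4 \<Rightarrow> complex ^ 4 \<Rightarrow> 4 \<Rightarrow> 4 \<Rightarrow> 4 \<Rightarrow> complex" where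
  "minor3 a b c i j k = a $ i * (b $ j * c $ k - b $ k * c $ j) - a $ j * (b $ i * c $ k - b $ k * c $ i)
     + a $ k * (b $ i * c $ j - b $ j * c $ i)"

text \<open>
  The covector \<open>det (a, b, c, _)\<close>: the plane in projective 3-space through three points.
\<close>

definition vol :: "complex ^ 4 \<Rightarrow> complex ^ 4 \<Rightarrow> complex ^ 4 \<Rightarrow> complex ^ 4" where
  "vol a b c = (\<chi> l. if l = 1 then - minor3 a b c 2 3 4 else if l = 2 then minor3 a b c 1 3 4
     else if l = 3 then - minor3 a b c 1 2 4 else minor3 a b c 1 2 3)"

lemma vol_nth: "vol a b c $ 1 = - minor3 a b c 2 3 4" "vol a b c $ 2 = minor3 a b c 1 3 4"
  "vol a b c $ 3 = - minor3 a b c 1 2 4" "vol a b c $ 4 = minor3 a b c 1 2 3"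
  by (simp_all add: vol_def)

lemma vol_orthogonal: "scalar_product (vol a b c) a = 0" "scalar_product (vol a b c) b = 0"
  "scalar_product (vol a b c) c = 0"
  by (simp_all add: scalar_product_def sum_4 vol_nth minor3_def algebra_simps)

lemma vol_add: "vol (a + a') b c = vol a b c + vol a' b c" "vol a (b + b') c = vol a b c + vol a b' c"
  "vol a b (c + c') = vol a b c + vol a b c'"
  by (simp_all add: vec_eq_iff forall_4 vol_nth minor3_def algebra_simps)

lemma vol_smult: "vol (s *s a) b c = s *s vol a b c" "vol a (s *s b) c = s *s vol a b c"
  "vol a b (s *s c) = s *s vol a b c"
  by (simp_all add: vec_eq_iff forall_4 vol_nth minor3_def algebra_simps)

lemma vol_alternating: "vol a a c = 0" "vol a c c = 0" "vol c a c = 0"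
  by (simp_all add: vec_eq_iff forall_4 vol_nth minor3_def algebra_simps)

lemma vol_swap: "vol b a c = - vol a b c" "vol a c b = - vol a b c"
  by (simp_all add: vec_eq_iff forall_4 vol_nth minor3_def algebra_simps)

lemma vol_zero_imp_minor3: "vol a b c = 0 \<Longrightarrow> minor3 a b c i j k = 0"
proof -
  assume "vol a b c = 0"
  then have 0: "minor3 a b c 2 3 4 = 0" "minor3 a b c 1 3 4 = 0" "minor3 a b c 1 2 4 = 0" "minor3 a b c 1 2 3 = 0"
    using vol_nth[of a b c] by simp_all
  have "\<forall>i j k. minor3 a b c i j k = 0"
    unfolding forall_4 using 0 unfolding minor3_def by (auto simp: algebra_simps)
  then show ?thesis by blast
qed

lemma indep2_imp_minor:
  assumes "indep2 a b"
  shows "\<exists>p q. a $ p * b $ q - a $ q * b $ p \<noteq> 0"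
proof (rule ccontr)
  assume "\<not> ?thesis"
  then have 0: "a $ p * b $ q = a $ q * b $ p" for p q by auto
  obtain p where p: "a $ p \<noteq> 0" using indep2_nonzero[OF assms] by (auto simp: vec_eq_iff)
  have "b = (b $ p / a $ p) *s a"
    using p 0[of p] by (simp add: vec_eq_iff field_simps)
  with assms show False by (auto simp: indep2_iff)
qed

text \<open>
  If all \<open>3\<times>3\<close> minors of \<open>a, b, c\<close> vanish, then expanding the minors with rows \<open>p, q, k\<close> along a
  nonzero \<open>2\<times>2\<close> minor of \<open>a, b\<close> with rows \<open>p, q\<close> solves for the coordinates of \<open>c\<close>.
\<close>

lemma vol_eq_0_imp_span:
  assumes "indep2 a b" "vol a b c = 0"
  shows "c \<in> vec.span {a, b}"
proof -
  obtain p q where pq: "a $ p * b $ q - a $ q * b $ p \<noteq> 0" (is "?w \<noteq> 0")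
    using indep2_imp_minor[OF assms(1)] by blast
  have "?w * c $ k = (a $ p * c $ q - a $ q * c $ p) * b $ k - (b $ p * c $ q - b $ q * c $ p) * a $ k" for k
    using vol_zero_imp_minor3[OF assms(2), of p q k] by (simp add: minor3_def algebra_simps)
  then have "c = (- (b $ p * c $ q - b $ q * c $ p) / ?w) *s a + ((a $ p * c $ q - a $ q * c $ p) / ?w) *s b"
    using pq by (simp add: vec_eq_iff divide_simps) (simp add: algebra_simps)
  then show ?thesis unfolding in_span_2 by blast
qed

lemma vol_nonzero_iff: "vol a b c \<noteq> 0 \<longleftrightarrow> indep2 a b \<and> c \<notin> vec.span {a, b}"
proof
  assume v: "vol a b c \<noteq> 0"
  have "a \<noteq> 0" using v vol_smult(1)[of 0 0 b c] by auto
  moreover have "b \<noteq> s *s a" for s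
    using v vol_smult(2)[of a s a c] vol_alternating by auto
  moreover have "c \<notin> vec.span {a, b}"
    using v by (auto simp: in_span_2 vol_add vol_smult vol_alternating)
  ultimately show "indep2 a b \<and> c \<notin> vec.span {a, b}" by (simp add: indep2_iff)
next
  assume "indep2 a b \<and> c \<notin> vec.span {a, b}"
  then show "vol a b c \<noteq> 0" using vol_eq_0_imp_span by blast
qed

lemma vol_unique:
  assumes "vol a b c \<noteq> 0" "scalar_product a x = 0" "scalar_product b x = 0" "scalar_product c x = 0"
  shows "\<exists>s. x = s *s vol a b c"
proof (rule orthogonal_unique[where S = "{c, a, b}"])
  show "CARD(4) \<le> vec.dim {c, a, b} + 1"
    using assms(1) vec.dim_insert[of c "{a, b}"] dim_2_iff[of a b] by (simp add: vol_nonzero_iff)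
qed (use assms vol_orthogonal[of a b c] in \<open>auto simp: scalar_product_commute\<close>)

lemma exists_not_in_span:
  fixes S :: "(complex ^ 'n) set"
  assumes "finite W" "card W < vec.dim S"
  shows "\<exists>s\<in>S. s \<notin> vec.span W"
  using vec.dim_le_card[of S W] assms by force

lemma exists_vol_nonzero:
  assumes "vec.dim S \<ge> 3"
  shows "\<exists>a\<in>S. \<exists>b\<in>S. \<exists>c\<in>S. vol a b c \<noteq> 0"
proof -
  obtain a where a: "a \<in> S" "a \<notin> vec.span {}"
    using exists_not_in_span[of "{}" S] assms by auto
  obtain b where b: "b \<in> S" "b \<notin> vec.span {a}"
    using exists_not_in_span[of "{a}" S] assms by auto
  have "card {a, b} \<le> 2" by (simp add: card_insert_if)
  then obtain c where c: "c \<in> S" "c \<notin> vec.span {a, b}"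
    using exists_not_in_span[of "{a, b}" S] assms by auto
  have "indep2 a b" using a(2) b(2) by (auto simp: indep2_iff vec.span_singleton)
  then show ?thesis using a b c vol_nonzero_iff by blast
qed

text \<open>
  The existence of a common orthogonal vector is a condition on determinants; this is what
  makes it a polynomial condition.  If three elements of \<open>S\<close> are independent, their \<open>vol\<close> is, up
  to a factor, the only candidate.
\<close>

lemma common_orthogonal_iff:
  fixes S :: "(complex ^ 4) set"
  shows "(\<exists>x. x \<noteq> 0 \<and> (\<forall>s\<in>S. scalar_product s x = 0)) \<longleftrightarrow>
    (\<forall>a\<in>S. \<forall>b\<in>S. \<forall>c\<in>S. \<forall>d\<in>S. scalar_product (vol a b c) d = 0)"
proof
  assume "\<exists>x. x \<noteq> 0 \<and> (\<forall>s\<in>S. scalar_product s x = 0)"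
  then obtain x where x: "x \<noteq> 0" "\<forall>s\<in>S. scalar_product s x = 0" by blast
  show "\<forall>a\<in>S. \<forall>b\<in>S. \<forall>c\<in>S. \<forall>d\<in>S. scalar_product (vol a b c) d = 0"
  proof (intro ballI)
    fix a b c d assume S: "a \<in> S" "b \<in> S" "c \<in> S" "d \<in> S"
    show "scalar_product (vol a b c) d = 0"
    proof (cases "vol a b c = 0")
      case False
      then obtain s where s: "x = s *s vol a b c" using vol_unique x S by blast
      with x(1) have "s \<noteq> 0" by auto
      then show ?thesis using x(2) S(4) s by (auto simp: scalar_product_smult scalar_product_commute)
    qed simp
  qed
next
  assume r: "\<forall>a\<in>S. \<forall>b\<in>S. \<forall>c\<in>S. \<forall>d\<in>S. scalar_product (vol a b c) d = 0"
  show "\<exists>x. x \<noteq> 0 \<and> (\<forall>s\<in>S. scalar_product s x = 0)"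
  proof (cases "vec.dim S < 4")
    case True
    then show ?thesis using exists_orthogonal[of S] by simp
  next
    case False
    then obtain a b c where "a \<in> S" "b \<in> S" "c \<in> S" "vol a b c \<noteq> 0"
      using exists_vol_nonzero[of S] by auto
    then show ?thesis using r scalar_product_commute by metis
  qed
qed

lemma dim_le_2_imp_orthogonal_pair:
  fixes S :: "(complex ^ 4) set"
  assumes "vec.dim S \<le> 2"
  shows "\<exists>u v. indep2 u v \<and> (\<forall>s\<in>S. scalar_product s u = 0 \<and> scalar_product s v = 0)"
proof -
  obtain u where u: "u \<noteq> 0" "\<forall>s\<in>S. scalar_product s u = 0"
    using exists_orthogonal[of S] assms by auto
  obtain d where d: "scalar_product d u \<noteq> 0"
    using scalar_product_all_zero[of u] u(1) by (metis scalar_product_commute)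
  have "vec.dim (insert d S) < CARD(4)"
    using assms by (simp add: vec.dim_insert)
  then obtain v where v: "v \<noteq> 0" "\<forall>s\<in>insert d S. scalar_product s v = 0"
    using exists_orthogonal[of "insert d S"] by auto
  have "v \<noteq> a *s u" for a
    using v d by (auto simp: scalar_product_smult)
  then have "indep2 u v" using u(1) by (simp add: indep2_iff)
  then show ?thesis using u v by blast
qed

text \<open>
  This turns a bound on a rank into solvability of linear systems in \<open>\<complex>\<^sup>4\<close>: the vectors orthogonal
  to \<open>S\<close> form a space of dimension at least two as soon as every hyperplane contains a nonzero one.
\<close>

lemma dim_le_2_if_orthogonal:
  fixes S :: "(complex ^ 4) set"
  assumes "\<And>v. \<exists>x. x \<noteq> 0 \<and> (\<forall>s\<in>insert v S. scalar_product s x = 0)"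
  shows "vec.dim S \<le> 2"
proof (rule ccontr)
  assume "\<not> ?thesis"
  then obtain a b c where abc: "a \<in> S" "b \<in> S" "c \<in> S" "vol a b c \<noteq> 0"
    using exists_vol_nonzero[of S] by auto
  obtain d where d: "scalar_product d (vol a b c) \<noteq> 0"
    using scalar_product_all_zero[of "vol a b c"] abc(4) by (metis scalar_product_commute)
  obtain x where x: "x \<noteq> 0" "\<forall>s\<in>insert d S. scalar_product s x = 0"
    using assms by blast
  then obtain s where "x = s *s vol a b c" using vol_unique abc by blast
  with x d show False by (auto simp: scalar_product_smult)
qed

text \<open>
  The space of vectors of the dual line \<open>E\<^sup>*\<close>.
\<close>

definition conj_complement :: "(complex ^ 4) set \<Rightarrow> (complex ^ 4) set" where
  "conj_complement E = {p. \<forall>q\<in>E. scalar_product (\<chi> i. cnj (p $ i)) q = 0}"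

lemma subspace_conj_complement: "vec.subspace (conj_complement E)"
proof (rule vec.subspaceI)
  fix x y c
  assume x: "x \<in> conj_complement E"
  show "c *s x \<in> conj_complement E"
    using x by (simp add: conj_complement_def scalar_product_def mult.assoc flip: sum_distrib_left)
  assume y: "y \<in> conj_complement E"
  show "x + y \<in> conj_complement E"
    using x y by (simp add: conj_complement_def scalar_product_def algebra_simps sum.distrib)
qed (simp add: conj_complement_def scalar_product_def)

lemma conj_complement_disjoint:
  assumes "x \<in> E" "x \<in> conj_complement E"
  shows "x = 0"
proof -
  have "(\<Sum>i\<in>UNIV. cnj (x $ i) * x $ i) = 0"
    using assms by (auto simp: conj_complement_def scalar_product_def)
  then have "complex_of_real (\<Sum>i\<in>UNIV. (cmod (x $ i))\<^sup>2) = 0"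
    by (simp add: complex_norm_square mult.commute del: of_real_power)
  then have "(\<Sum>i\<in>UNIV. (cmod (x $ i))\<^sup>2) = 0"
    using of_real_eq_0_iff by blast
  then show ?thesis
    by (simp add: sum_nonneg_eq_0_iff vec_eq_iff)
qed

text \<open>
  Two independent vectors orthogonal to the conjugates of \<open>e1, e2\<close> lie in the complement.  Since
  the complement meets the span of \<open>e1, e2\<close> only in zero, the four vectors form a basis of \<open>\<complex>\<^sup>4\<close>.
\<close>

lemma conj_complement_span:
  assumes "indep2 e1 e2"
  shows "\<exists>w1 w2. indep2 w1 w2 \<and> conj_complement (vec.span {e1, e2}) = vec.span {w1, w2} \<and>
    (\<forall>x. \<exists>e\<in>vec.span {e1, e2}. \<exists>w\<in>vec.span {w1, w2}. x = e + w)"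
proof -
  let ?E = "vec.span {e1, e2}" let ?N = "conj_complement ?E"
  let ?c = "\<lambda>x :: complex ^ 4. \<chi> i. cnj (x $ i)"
  have "vec.dim {?c e1, ?c e2} \<le> card {?c e1, ?c e2}"
    by (rule vec.dim_le_card) (auto simp: vec.span_base)
  also have "\<dots> \<le> 2" by (simp add: card_insert_if)
  finally obtain w1 w2 where w: "indep2 w1 w2"
    "\<forall>s\<in>{?c e1, ?c e2}. scalar_product s w1 = 0 \<and> scalar_product s w2 = 0"
    using dim_le_2_imp_orthogonal_pair by blast
  have N: "x \<in> ?N" if x: "scalar_product (?c e1) x = 0" "scalar_product (?c e2) x = 0" for x
  proof -
    have eq: "scalar_product (?c x) e = cnj (scalar_product (?c e) x)" for e
      by (simp add: scalar_product_def mult.commute)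
    have "scalar_product (?c x) (a *s e1 + b *s e2) = 0" for a b
      unfolding scalar_product_simps eq x by simp
    then show ?thesis
      by (auto simp: conj_complement_def in_span_2)
  qed
  have wN: "w1 \<in> ?N" "w2 \<in> ?N" using w(2) by (auto intro: N)
  have disj: "x = 0" if "x \<in> ?E" "x \<in> ?N" for x using conj_complement_disjoint that .
  have "w1 \<notin> ?E" using disj wN indep2_nonzero[OF w(1)] by blast
  moreover have "w2 \<notin> vec.span {w1, e1, e2}"
  proof
    assume "w2 \<in> vec.span {w1, e1, e2}"
    then obtain k where k: "w2 - k *s w1 \<in> ?E" by (auto simp: vec.span_breakdown_eq[of w2 w1])
    moreover have "w2 - k *s w1 \<in> ?N"
      by (intro vec.subspace_diff vec.subspace_scale subspace_conj_complement wN)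
    ultimately have "w2 = k *s w1" using disj by fastforce
    then show False using w(1) by (auto simp: indep2_iff)
  qed
  ultimately have "vec.dim {w2, w1, e1, e2} = 4"
    using vec.dim_insert[of w2 "{w1, e1, e2}"] vec.dim_insert[of w1 "{e1, e2}"] assms dim_2_iff[of e1 e2]
    by simp
  then have "vec.span {w2, w1, e1, e2} = UNIV"
    using vec.dim_eq_full[of "{w2, w1, e1, e2}"] by (simp add: vec.dimension_def card_cart_basis)
  moreover have "{w2, w1, e1, e2} = {w1, w2} \<union> {e1, e2}" by blast
  ultimately have univ: "vec.span ({w1, w2} \<union> {e1, e2}) = UNIV" by metis
  have dec: "\<exists>e\<in>?E. \<exists>w\<in>vec.span {w1, w2}. x = e + w" for x
  proof -
    have "x \<in> vec.span ({w1, w2} \<union> {e1, e2})" using univ by blast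
    then have "\<exists>w e. x = w + e \<and> w \<in> vec.span {w1, w2} \<and> e \<in> ?E"
      by (simp only: vec.span_Un mem_Collect_eq)
    then obtain w e where "w \<in> vec.span {w1, w2}" "e \<in> ?E" "x = w + e" by blast
    then show ?thesis by (intro bexI[of _ e] bexI[of _ w]) auto
  qed
  have sub: "vec.span {w1, w2} \<subseteq> ?N"
    using wN by (intro vec.span_minimal subspace_conj_complement) auto
  have "?N \<subseteq> vec.span {w1, w2}"
  proof
    fix x assume x: "x \<in> ?N"
    obtain e w' where ew: "e \<in> ?E" "w' \<in> vec.span {w1, w2}" "x = e + w'" using dec by blast
    have "x - w' \<in> ?N" using x sub ew(2) by (intro vec.subspace_diff subspace_conj_complement) auto
    then have "e \<in> ?N" using ew(3) by simp
    with ew(1) have "e = 0" by (rule disj)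
    then show "x \<in> vec.span {w1, w2}" using ew by simp
  qed
  then show ?thesis using sub w(1) dec by blast
qed

section \<open>Lines in projective space and their Pluecker coordinates\<close>

lemma proj_eq_iff: "p = q \<longleftrightarrow> (\<exists>a. rep_proj q = a *s rep_proj p)"
proof -
  have "p = q \<longleftrightarrow> proj_rel (rep_proj p) (rep_proj q)"
    by (simp add: Quotient3_rel_rep[OF Quotient3_proj])
  then show ?thesis
    using rep_proj_nonzero[of p] rep_proj_nonzero[of q] by (auto simp: proj_rel_def)
qed

lemma proj_neq_iff: "p \<noteq> q \<longleftrightarrow> indep2 (rep_proj p) (rep_proj q)"
  by (simp add: indep2_iff rep_proj_nonzero proj_eq_iff)

lemma abs_proj_eq:
  assumes "x \<noteq> 0" "a \<noteq> 0"
  shows "abs_proj (a *s x) = abs_proj x"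
proof -
  have "proj_rel x (a *s x)"
    using assms by (auto simp: proj_rel_def)
  then show ?thesis
    using Quotient3_rel_abs[OF Quotient3_proj] by metis
qed

definition proj_of :: "(complex ^ 'n::finite) set \<Rightarrow> 'n proj set" where
  "proj_of V = {p. rep_proj p \<in> V}"

lemma abs_proj_in_proj_of:
  assumes "vec.subspace V" "x \<noteq> 0"
  shows "abs_proj x \<in> proj_of V \<longleftrightarrow> x \<in> V"
proof -
  obtain a where a: "a \<noteq> 0" "rep_proj (abs_proj x) = a *s x"
    using rep_proj_abs_proj[OF assms(2)] by blast
  have "x = inverse a *s (a *s x)" using a(1) by (simp add: vector_smult_assoc)
  then show ?thesis
    using a(2) assms(1) vec.subspace_scale by (metis mem_Collect_eq proj_of_def)
qed

lemma proj_of_mono_iff: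
  assumes "vec.subspace V" "vec.subspace W"
  shows "proj_of V \<subseteq> proj_of W \<longleftrightarrow> V \<subseteq> W"
proof
  assume l: "proj_of V \<subseteq> proj_of W"
  show "V \<subseteq> W"
  proof
    fix x assume "x \<in> V"
    then show "x \<in> W"
      using l abs_proj_in_proj_of[OF assms(1), of x] abs_proj_in_proj_of[OF assms(2), of x]
        vec.subspace_0[OF assms(2)] by (cases "x = 0") auto
  qed
qed (auto simp: proj_of_def)

lemma proj_span_eq: "proj_span S = proj_of (vec.span (rep_proj ` S))"
  by (simp add: proj_span_def proj_of_def)

lemma proj_of_meet_iff:
  assumes "vec.subspace V" "vec.subspace W"
  shows "proj_of V \<inter> proj_of W \<noteq> {} \<longleftrightarrow> (\<exists>x. x \<noteq> 0 \<and> x \<in> V \<and> x \<in> W)"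
proof
  assume "\<exists>x. x \<noteq> 0 \<and> x \<in> V \<and> x \<in> W"
  then obtain x where "x \<noteq> 0" "x \<in> V" "x \<in> W" by blast
  then have "abs_proj x \<in> proj_of V \<inter> proj_of W"
    using abs_proj_in_proj_of assms by blast
  then show "proj_of V \<inter> proj_of W \<noteq> {}" by blast
qed (use rep_proj_nonzero in \<open>auto simp: proj_of_def\<close>)

lemma span_pair_eq:
  assumes "indep2 u v" "indep2 u' v'" "u' \<in> vec.span {u, v}" "v' \<in> vec.span {u, v}"
  shows "vec.span {u', v'} = vec.span {u, v}"
proof (rule vec.subspace_dim_equal)
  show "vec.span {u', v'} \<subseteq> vec.span {u, v}"
    using assms(3,4) by (intro vec.span_minimal) auto
  show "vec.dim (vec.span {u, v}) \<le> vec.dim (vec.span {u', v'})"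
    using assms(1,2) by (simp add: dim_2_iff[symmetric])
qed auto

lemma span_pair_smult:
  assumes "a \<noteq> 0" "b \<noteq> 0"
  shows "vec.span {a *s u, b *s v} = vec.span {u, v}"
proof (intro vec.span_eq[THEN iffD2] conjI subsetI)
  fix x assume "x \<in> {a *s u, b *s v}"
  then show "x \<in> vec.span {u, v}" by (auto intro: vec.span_scale vec.span_base)
next
  fix x assume "x \<in> {u, v}"
  moreover have "u = inverse a *s (a *s u)" "v = inverse b *s (b *s v)"
    using assms by (simp_all add: vector_smult_assoc)
  ultimately show "x \<in> vec.span {a *s u, b *s v}"
    by (metis insertE insertI1 insertI2 singletonD vec.span_base vec.span_scale)
qed

lemma indep2_smult:
  assumes "a \<noteq> 0" "b \<noteq> 0" "indep2 u v"
  shows "indep2 (a *s u) (b *s v)"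
  using assms unfolding indep2_def vector_smult_assoc by (metis mult_eq_0_iff)

lemma grass_iff: "L \<in> grass \<longleftrightarrow> (\<exists>u v. indep2 u v \<and> L = proj_of (vec.span {u, v}))"
proof
  assume "L \<in> grass"
  then obtain x y where "x \<noteq> y" "L = proj_span {x, y}" by (auto simp: grass_def is_line_def)
  then show "\<exists>u v. indep2 u v \<and> L = proj_of (vec.span {u, v})"
    by (auto simp: proj_neq_iff proj_span_eq intro!: exI)
next
  assume "\<exists>u v. indep2 u v \<and> L = proj_of (vec.span {u, v})"
  then obtain u v where uv: "indep2 u v" "L = proj_of (vec.span {u, v})" by blast
  obtain a where a: "a \<noteq> 0" "rep_proj (abs_proj u) = a *s u"
    using rep_proj_abs_proj indep2_nonzero(1)[OF uv(1)] by blast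
  obtain b where b: "b \<noteq> 0" "rep_proj (abs_proj v) = b *s v"
    using rep_proj_abs_proj indep2_nonzero(2)[OF uv(1)] by blast
  have "abs_proj u \<noteq> abs_proj v"
    using indep2_smult[OF a(1) b(1) uv(1)] by (simp add: proj_neq_iff a b)
  moreover have "L = proj_span {abs_proj u, abs_proj v}"
    using span_pair_smult[OF a(1) b(1), of u v] by (simp add: proj_span_eq a b uv(2))
  ultimately show "L \<in> grass" by (auto simp: grass_def is_line_def)
qed

definition wedge :: "complex ^ 4 \<Rightarrow> complex ^ 4 \<Rightarrow> complex ^ (4 \<times> 4)" where
  "wedge u v = vec_lambda (\<lambda>(i, j). u $ i * v $ j - u $ j * v $ i)"

lemma wedge_nonzero: "indep2 u v \<Longrightarrow> wedge u v \<noteq> 0"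
  using indep2_imp_minor[of u v] by (auto simp: vec_eq_iff wedge_def)

lemma wedge_span:
  assumes "u' \<in> vec.span {u, v}" "v' \<in> vec.span {u, v}"
  shows "\<exists>s. wedge u' v' = s *s wedge u v"
proof -
  obtain a b c d where "u' = a *s u + b *s v" "v' = c *s u + d *s v"
    using assms by (auto simp: in_span_2)
  then have "wedge u' v' = (a * d - b * c) *s wedge u v"
    by (auto simp: vec_eq_iff wedge_def algebra_simps)
  then show ?thesis by blast
qed

text \<open>
  Changing the basis of the 2-dimensional space multiplies all Pluecker coordinates by the
  determinant of the change of basis, so the definite description denotes one point.
\<close>

lemma pluecker_eq:
  assumes "indep2 u v"
  shows "pluecker (proj_of (vec.span {u, v})) = abs_proj (wedge u v)"
proof -
  let ?L = "proj_of (vec.span {u, v})"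
  have L: "?L \<in> grass" using assms grass_iff by blast
  then obtain x y where "x \<noteq> y" and L: "?L = proj_span {x, y}"
    unfolding grass_def is_line_def by blast
  moreover have "x \<in> ?L" "y \<in> ?L"
    unfolding L by (simp_all add: proj_span_def vec.span_base)
  ultimately have xy: "x \<in> ?L" "y \<in> ?L" "x \<noteq> y" by simp_all
  have *: "abs_proj (wedge (rep_proj p) (rep_proj q)) = abs_proj (wedge u v)"
    if "p \<in> ?L" "q \<in> ?L" "p \<noteq> q" for p q
  proof -
    have "rep_proj p \<in> vec.span {u, v}" "rep_proj q \<in> vec.span {u, v}"
      using that(1,2) by (simp_all add: proj_of_def)
    then obtain s where s: "wedge (rep_proj p) (rep_proj q) = s *s wedge u v"
      using wedge_span by blast
    then have "s \<noteq> 0" using wedge_nonzero[of "rep_proj p" "rep_proj q"] that(3) by (auto simp: proj_neq_iff)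
    then show ?thesis using s abs_proj_eq wedge_nonzero[OF assms] by metis
  qed
  show ?thesis
    unfolding pluecker_def wedge_def[symmetric]
  proof (rule the_equality)
    show "\<exists>x\<in>?L. \<exists>y\<in>?L. x \<noteq> y \<and> abs_proj (wedge u v) = abs_proj (wedge (rep_proj x) (rep_proj y))"
      using *[OF xy] xy by (intro bexI[of _ x] bexI[of _ y]) auto
  qed (use * in blast)
qed

lemma rep_proj_pluecker:
  assumes "indep2 u v"
  shows "\<exists>a. a \<noteq> 0 \<and> rep_proj (pluecker (proj_of (vec.span {u, v}))) = a *s wedge u v"
  unfolding pluecker_eq[OF assms] by (rule rep_proj_abs_proj[OF wedge_nonzero[OF assms]])

section \<open>Multihomogeneous functions and polynomial curves\<close>

definition monomial :: "('m::finite \<Rightarrow> 'n::finite \<Rightarrow> nat) \<Rightarrow> ('m \<Rightarrow> complex ^ 'n) \<Rightarrow> complex" where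
  "monomial \<alpha> x = (\<Prod>i\<in>UNIV. \<Prod>j\<in>UNIV. x i $ j ^ \<alpha> i j)"

lemma multihomogeneous_iff: "multihomogeneous d f \<longleftrightarrow> (\<exists>A c. finite A \<and> (\<forall>\<alpha>\<in>A. \<forall>i. (\<Sum>j\<in>UNIV. \<alpha> i j) = d i) \<and>
    f = (\<lambda>x. \<Sum>\<alpha>\<in>A. c \<alpha> * monomial \<alpha> x))"
  by (simp add: multihomogeneous_def monomial_def)

lemma multihomogeneous_add:
  assumes "multihomogeneous d f" "multihomogeneous d g"
  shows "multihomogeneous d (\<lambda>x. f x + g x)"
proof -
  obtain A a where A: "finite A" "\<forall>\<alpha>\<in>A. \<forall>i. (\<Sum>j\<in>UNIV. \<alpha> i j) = d i" "f = (\<lambda>x. \<Sum>\<alpha>\<in>A. a \<alpha> * monomial \<alpha> x)"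
    using assms(1) unfolding multihomogeneous_iff by blast
  obtain B b where B: "finite B" "\<forall>\<alpha>\<in>B. \<forall>i. (\<Sum>j\<in>UNIV. \<alpha> i j) = d i" "g = (\<lambda>x. \<Sum>\<alpha>\<in>B. b \<alpha> * monomial \<alpha> x)"
    using assms(2) unfolding multihomogeneous_iff by blast
  define a' b' where "a' \<alpha> = (if \<alpha> \<in> A then a \<alpha> else 0)" and "b' \<alpha> = (if \<alpha> \<in> B then b \<alpha> else 0)" for \<alpha>
  have "f x = (\<Sum>\<alpha>\<in>A \<union> B. a' \<alpha> * monomial \<alpha> x)" for x
    unfolding A(3) by (rule sum.mono_neutral_cong_left) (use A B in \<open>auto simp: a'_def\<close>)
  moreover have "g x = (\<Sum>\<alpha>\<in>A \<union> B. b' \<alpha> * monomial \<alpha> x)" for x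
    unfolding B(3) by (rule sum.mono_neutral_cong_left) (use A B in \<open>auto simp: b'_def\<close>)
  ultimately have "(\<lambda>x. f x + g x) = (\<lambda>x. \<Sum>\<alpha>\<in>A \<union> B. (a' \<alpha> + b' \<alpha>) * monomial \<alpha> x)"
    by (simp add: sum.distrib distrib_right)
  then show ?thesis
    unfolding multihomogeneous_iff using A B
    by (intro exI[of _ "A \<union> B"] exI[of _ "\<lambda>\<alpha>. a' \<alpha> + b' \<alpha>"]) auto
qed

lemma multihomogeneous_zero: "multihomogeneous d (\<lambda>x. 0)"
  unfolding multihomogeneous_def by (intro exI[of _ "{}"]) simp

lemma multihomogeneous_sum:
  assumes "\<And>s. s \<in> S \<Longrightarrow> multihomogeneous d (f s)"
  shows "multihomogeneous d (\<lambda>x. \<Sum>s\<in>S. f s x)"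
  using assms by (induction S rule: infinite_finite_induct) (auto intro: multihomogeneous_add multihomogeneous_zero)

lemma multihomogeneous_cmult:
  assumes "multihomogeneous d f"
  shows "multihomogeneous d (\<lambda>x. a * f x)"
  using multihomogeneous_mult[OF multihomogeneous_const[of a] assms] by simp

lemma multihomogeneous_diff:
  assumes "multihomogeneous d f" "multihomogeneous d g"
  shows "multihomogeneous d (\<lambda>x. f x - g x)"
  using multihomogeneous_add[OF assms(1) multihomogeneous_cmult[OF assms(2), of "-1"]] by simp

lemma multihomogeneous_coordinate:
  fixes i :: "'m::finite" and j :: "'n::finite"
  shows "multihomogeneous (\<lambda>i'. if i' = i then 1 else 0) (\<lambda>x. x i $ j)"
proof -
  define \<alpha> where "\<alpha> i' j' = (if i' = i \<and> j' = j then 1 else 0 :: nat)" for i' j'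
  have "(\<Prod>j'\<in>UNIV. x i' $ j' ^ \<alpha> i' j') = (if i' = i then x i $ j else 1)" for x :: "'m \<Rightarrow> complex ^ 'n" and i'
  proof (cases "i' = i")
    case True
    have "(\<Prod>j'\<in>UNIV. x i' $ j' ^ \<alpha> i' j') = (\<Prod>j'\<in>UNIV. if j' = j then x i $ j else 1)"
      by (rule prod.cong) (auto simp: \<alpha>_def True)
    then show ?thesis using True by simp
  qed (simp add: \<alpha>_def)
  then have "monomial \<alpha> x = x i $ j" for x
    by (simp add: monomial_def)
  moreover have "(\<Sum>j'\<in>UNIV. \<alpha> i' j') = (if i' = i then 1 else 0)" for i'
    by (simp add: \<alpha>_def)
  ultimately show ?thesis
    unfolding multihomogeneous_iff by (intro exI[of _ "{\<alpha>}"] exI[of _ "\<lambda>_. 1"]) simp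
qed

lemma multihomogeneous_smult:
  assumes "multihomogeneous d f"
  shows "f (\<lambda>i. a i *s x i) = (\<Prod>i\<in>UNIV. a i ^ d i) * f x"
proof -
  obtain A c where A: "finite A" "\<forall>\<alpha>\<in>A. \<forall>i. (\<Sum>j\<in>UNIV. \<alpha> i j) = d i" "f = (\<lambda>x. \<Sum>\<alpha>\<in>A. c \<alpha> * monomial \<alpha> x)"
    using assms unfolding multihomogeneous_iff by blast
  have "monomial \<alpha> (\<lambda>i. a i *s x i) = (\<Prod>i\<in>UNIV. a i ^ d i) * monomial \<alpha> x" if "\<alpha> \<in> A" for \<alpha>
    using A(2) that
    by (simp add: monomial_def power_mult_distrib prod.distrib flip: power_sum)
  then show ?thesis
    by (simp add: A(3) sum_distrib_left mult_ac)
qed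

text \<open>
  Vectors \<open>x i\<close> that represent the points \<open>p i\<close>, with arbitrary scaling; curves are given in such
  coordinates, since those chosen by \<open>rep_proj\<close> need not vary polynomially along a curve.
\<close>

definition homogeneous_coords :: "('m \<Rightarrow> complex ^ 'n::finite) \<Rightarrow> ('m \<Rightarrow> 'n proj) \<Rightarrow> bool" where
  "homogeneous_coords x p \<longleftrightarrow> (\<forall>i. \<exists>a. a \<noteq> 0 \<and> x i = a *s rep_proj (p i))"

lemma multihomogeneous_coords_zero_iff:
  assumes "multihomogeneous d f" "homogeneous_coords x p"
  shows "f x = 0 \<longleftrightarrow> f (\<lambda>i. rep_proj (p i)) = 0"
proof -
  obtain a where a: "\<And>i. a i \<noteq> 0 \<and> x i = a i *s rep_proj (p i)"
    using assms(2) unfolding homogeneous_coords_def by metis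
  then have "x = (\<lambda>i. a i *s rep_proj (p i))" by auto
  then show ?thesis
    using multihomogeneous_smult[OF assms(1), of a "\<lambda>i. rep_proj (p i)"] a by simp
qed

definition poly_fun :: "(complex \<Rightarrow> complex) \<Rightarrow> bool" where
  "poly_fun g \<longleftrightarrow> (\<exists>p. \<forall>t. g t = poly p t)"

lemma poly_fun_const [intro]: "poly_fun (\<lambda>t. c)"
  unfolding poly_fun_def by (intro exI[of _ "[:c:]"]) simp

lemma poly_fun_ident [intro]: "poly_fun (\<lambda>t. t)"
  unfolding poly_fun_def by (intro exI[of _ "[:0, 1:]"]) simp

lemma poly_fun_add [intro]: "poly_fun f \<Longrightarrow> poly_fun g \<Longrightarrow> poly_fun (\<lambda>t. f t + g t)"
  unfolding poly_fun_def by (metis poly_add)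

lemma poly_fun_diff [intro]: "poly_fun f \<Longrightarrow> poly_fun g \<Longrightarrow> poly_fun (\<lambda>t. f t - g t)"
  unfolding poly_fun_def by (metis poly_diff)

lemma poly_fun_mult [intro]: "poly_fun f \<Longrightarrow> poly_fun g \<Longrightarrow> poly_fun (\<lambda>t. f t * g t)"
  unfolding poly_fun_def by (metis poly_mult)

lemma poly_fun_power [intro]: "poly_fun f \<Longrightarrow> poly_fun (\<lambda>t. f t ^ n)"
  unfolding poly_fun_def by (metis poly_power)

lemma poly_fun_sum [intro]: "(\<And>s. s \<in> S \<Longrightarrow> poly_fun (f s)) \<Longrightarrow> poly_fun (\<lambda>t. \<Sum>s\<in>S. f s t)"
  by (induction S rule: infinite_finite_induct) auto

lemma poly_fun_prod [intro]: "(\<And>s. s \<in> S \<Longrightarrow> poly_fun (f s)) \<Longrightarrow> poly_fun (\<lambda>t. \<Prod>s\<in>S. f s t)"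
  by (induction S rule: infinite_finite_induct) auto

lemma poly_fun_zero:
  assumes "poly_fun g" "infinite {t. g t = 0}"
  shows "g t = 0"
proof -
  obtain p where p: "\<And>t. g t = poly p t" using assms(1) unfolding poly_fun_def by blast
  then have "p = 0" using assms(2) poly_roots_finite by auto
  then show ?thesis using p by simp
qed

lemma poly_fun_multihomogeneous:
  assumes "multihomogeneous d f" "\<And>i j. poly_fun (\<lambda>t. x t i $ j)"
  shows "poly_fun (\<lambda>t. f (x t))"
proof -
  obtain A c where A: "finite A" "f = (\<lambda>x. \<Sum>\<alpha>\<in>A. c \<alpha> * monomial \<alpha> x)"
    using assms unfolding multihomogeneous_iff by blast
  show ?thesis
    unfolding A(2) monomial_def by (intro poly_fun_sum poly_fun_mult poly_fun_const poly_fun_prod poly_fun_power assms(2))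
qed

lemma closure_of_zariski_vanish:
  assumes "p \<in> zariski closure_of S" "multihomogeneous d f" "\<And>q. q \<in> S \<Longrightarrow> f (\<lambda>i. rep_proj (q i)) = 0"
  shows "f (\<lambda>i. rep_proj (p i)) = 0"
  using assms unfolding zariski_closure_of by blast

text \<open>
  The limit argument of the proof: a multihomogeneous function that vanishes at infinitely many
  points of a polynomial curve vanishes on all of it, in particular at the parameter zero.
\<close>

lemma zariski_closure_curve:
  assumes poly: "\<And>i j. poly_fun (\<lambda>t. x t i $ j)"
    and inf: "infinite {t. \<exists>q\<in>zariski closure_of S. homogeneous_coords (x t) q}"
    and lim: "homogeneous_coords (x 0) p"
  shows "p \<in> zariski closure_of S"
  unfolding zariski_closure_of
proof (intro CollectI allI impI)
  fix f d assume f: "multihomogeneous d f" and 0: "\<forall>q\<in>S. f (\<lambda>i. rep_proj (q i)) = 0"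
  have "f (x t) = 0" if "\<exists>q\<in>zariski closure_of S. homogeneous_coords (x t) q" for t
    using that closure_of_zariski_vanish[OF _ f] 0 multihomogeneous_coords_zero_iff[OF f] by blast
  then have "infinite {t. f (x t) = 0}"
    using inf by (rule_tac infinite_super) auto
  then have "f (x 0) = 0"
    by (intro poly_fun_zero[of "\<lambda>t. f (x t)"] poly_fun_multihomogeneous[OF f] poly)
  then show "f (\<lambda>i. rep_proj (p i)) = 0"
    using multihomogeneous_coords_zero_iff[OF f lim] by blast
qed

section \<open>Dimension of families of lines\<close>

lemma closedin_grass_separation:
  assumes "closedin (subtopology grass_zariski X) A" "L \<in> X" "X \<subseteq> grass" "L \<notin> A"
  shows "\<exists>f d. multihomogeneous d f \<and> f (\<lambda>_ :: 1. rep_proj (pluecker L)) \<noteq> 0 \<and>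
    (\<forall>T\<in>A. f (\<lambda>_. rep_proj (pluecker T)) = 0)"
proof -
  have top: "topspace (subtopology grass_zariski X) = X"
    using assms(3) by (auto simp: grass_zariski_def topspace_pullback_topology topspace_zariski)
  have "openin (subtopology grass_zariski X) (X - A)" "A \<subseteq> X"
    using assms(1) unfolding closedin_def top by auto
  then obtain V where V: "openin grass_zariski V" "X - A = V \<inter> X"
    unfolding openin_subtopology by blast
  then obtain U where U: "openin zariski U" "V = (\<lambda>L (_ :: 1). pluecker L) -` U \<inter> grass"
    unfolding grass_zariski_def openin_pullback_topology by blast
  have "(\<lambda>_. pluecker L) \<in> U" using V U assms by blast
  then obtain f d where f: "multihomogeneous d f" "(\<lambda>_. pluecker L) \<in> distinguished_open f" "distinguished_open f \<subseteq> U"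
    using openin_zariski_base[OF U(1)] by blast
  have "f (\<lambda>_. rep_proj (pluecker T)) = 0" if "T \<in> A" for T
  proof (rule ccontr)
    assume "f (\<lambda>_. rep_proj (pluecker T)) \<noteq> 0"
    then have "(\<lambda>_. pluecker T) \<in> U" using f(3) by (auto simp: distinguished_open_def)
    then have "T \<in> V \<inter> X" using that \<open>A \<subseteq> X\<close> assms(3) U by blast
    then show False using V(2) that by blast
  qed
  then show ?thesis using f(1,2) by (auto simp: distinguished_open_def)
qed

text \<open>
  Choose a point \<open>c\<close> of \<open>E\<close> outside \<open>T\<close>.  The condition that a line contains \<open>c\<close> is given by
  the minors \<open>minor3\<close> of its basis and \<open>c\<close>, which are linear forms in the Pluecker coordinates.
\<close>

lemma pluecker_separation:
  assumes "E \<in> grass" "T \<in> grass" "E \<noteq> T"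
  shows "\<exists>f :: (1 \<Rightarrow> complex ^ (4 \<times> 4)) \<Rightarrow> complex. \<exists>d. multihomogeneous d f \<and>
    f (\<lambda>_. rep_proj (pluecker E)) = 0 \<and> f (\<lambda>_. rep_proj (pluecker T)) \<noteq> 0"
proof -
  obtain u v where E: "indep2 u v" "E = proj_of (vec.span {u, v})" using assms(1) grass_iff by blast
  obtain u' v' where T: "indep2 u' v'" "T = proj_of (vec.span {u', v'})" using assms(2) grass_iff by blast
  have "\<not> {u, v} \<subseteq> vec.span {u', v'}"
    using span_pair_eq[OF T(1) E(1)] assms(3) E(2) T(2) by auto
  then obtain c where c: "c \<in> vec.span {u, v}" "c \<notin> vec.span {u', v'}"
    using vec.span_superset by blast
  have "vol u v c = 0" "vol u' v' c \<noteq> 0"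
    using c T(1) vol_nonzero_iff by blast+
  moreover have "vol u' v' c = 0" if "\<forall>i j k. minor3 u' v' c i j k = 0"
    using that by (simp add: vec_eq_iff vol_def)
  ultimately obtain i j k where ijk: "minor3 u v c i j k = 0" "minor3 u' v' c i j k \<noteq> 0"
    using vol_zero_imp_minor3 by blast
  define f :: "(1 \<Rightarrow> complex ^ (4 \<times> 4)) \<Rightarrow> complex"
    where "f y = c $ i * y 1 $ (j, k) - c $ j * y 1 $ (i, k) + c $ k * y 1 $ (i, j)" for y
  have f_wedge: "f (\<lambda>_. a *s wedge x y) = a * minor3 x y c i j k" for a x y
    by (simp add: f_def wedge_def minor3_def algebra_simps)
  have "multihomogeneous (\<lambda>i. if i = 1 then 1 else 0) f"
    unfolding f_def
    by (intro multihomogeneous_add multihomogeneous_diff multihomogeneous_cmult multihomogeneous_coordinate)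
  moreover have "f (\<lambda>_. rep_proj (pluecker E)) = 0"
    using rep_proj_pluecker[OF E(1)] E(2) f_wedge ijk by auto
  moreover have "f (\<lambda>_. rep_proj (pluecker T)) \<noteq> 0"
    using rep_proj_pluecker[OF T(1)] T(2) f_wedge ijk by auto
  ultimately show ?thesis by blast
qed

lemma closedin_grass_singleton:
  assumes "X \<subseteq> grass" "E \<in> X"
  shows "closedin (subtopology grass_zariski X) {E}"
proof -
  have top: "topspace (subtopology grass_zariski X) = X"
    using assms(1) by (auto simp: grass_zariski_def topspace_pullback_topology topspace_zariski)
  have "\<exists>V. openin (subtopology grass_zariski X) V \<and> T \<in> V \<and> V \<subseteq> X - {E}" if T: "T \<in> X - {E}" for T
  proof -
    obtain f :: "(1 \<Rightarrow> complex ^ (4 \<times> 4)) \<Rightarrow> complex" and d where f: "multihomogeneous d f"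
      "f (\<lambda>_. rep_proj (pluecker E)) = 0" "f (\<lambda>_. rep_proj (pluecker T)) \<noteq> 0"
      using pluecker_separation[of E T] T assms by blast
    define V where "V = ((\<lambda>L (_ :: 1). pluecker L) -` distinguished_open f \<inter> grass) \<inter> X"
    have "openin zariski (distinguished_open f)"
      unfolding zariski_def by (rule topology_generated_by_Basis) (use f in blast)
    then have "openin (subtopology grass_zariski X) V"
      unfolding V_def openin_subtopology grass_zariski_def openin_pullback_topology by blast
    moreover have "T \<in> V" "V \<subseteq> X - {E}"
      using f T assms(1) by (auto simp: V_def distinguished_open_def)
    ultimately show ?thesis by blast
  qed
  then have "openin (subtopology grass_zariski X) (X - {E})"
    by (subst openin_subopen) blast
  then show ?thesis unfolding closedin_def top using assms(2) by blast
qed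

lemma krull_dim_ge_1D:
  assumes "krull_dim T \<ge> 1"
  shows "\<exists>Z0 Z1. irreducible_closedin T Z0 \<and> irreducible_closedin T Z1 \<and> Z0 \<subset> Z1"
proof -
  have "(0 :: ereal) < krull_dim T" using assms by (rule less_le_trans[rotated]) simp
  then obtain n :: nat and Z where n: "0 < ereal (real n)" "\<forall>i\<le>n. irreducible_closedin T (Z i)" "\<forall>i<n. Z i \<subset> Z (Suc i)"
    unfolding krull_dim_def less_Sup_iff by blast
  then have "0 < n" by simp
  then show ?thesis using n(2,3) by (intro exI[of _ "Z 0"] exI[of _ "Z 1"]) auto
qed

lemma krull_dim_ge_1I:
  assumes "irreducible_closedin T Z0" "irreducible_closedin T Z1" "Z0 \<subset> Z1"
  shows "krull_dim T \<ge> 1"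
  unfolding krull_dim_def
proof (rule Sup_upper, intro CollectI exI conjI)
  show "1 = ereal (real 1)" by simp
  show "\<forall>i\<le>1. irreducible_closedin T ((\<lambda>i. if i = 0 then Z0 else Z1) i)" using assms by auto
  show "\<forall>i<1. (\<lambda>i. if i = 0 then Z0 else Z1) i \<subset> (\<lambda>i. if i = 0 then Z0 else Z1) (Suc i)" using assms by auto
qed

text \<open>
  Points of the Grassmannian are closed, so a set of at most two lines has no irreducible closed
  subset with more than one element.
\<close>

lemma not_krull_dim_ge_1_if_two_lines:
  assumes "X \<subseteq> grass" "X \<subseteq> {E, T}"
  shows "\<not> krull_dim (subtopology grass_zariski X) \<ge> 1"
proof
  assume "krull_dim (subtopology grass_zariski X) \<ge> 1"
  then obtain Z0 Z1 where Z: "irreducible_closedin (subtopology grass_zariski X) Z0"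
    "irreducible_closedin (subtopology grass_zariski X) Z1" "Z0 \<subset> Z1"
    using krull_dim_ge_1D by blast
  have "Z1 \<subseteq> topspace (subtopology grass_zariski X)"
    using Z(2) closedin_subset unfolding irreducible_closedin_def by blast
  then have "Z1 \<subseteq> X" by auto
  moreover have "Z0 \<noteq> {}" using Z(1) by (simp add: irreducible_closedin_def)
  ultimately obtain x y where xy: "x \<in> Z1" "y \<in> Z1" "x \<noteq> y" using Z(3) by blast
  have sub: "Z1 \<subseteq> {E, T}" using \<open>Z1 \<subseteq> X\<close> assms(2) by (rule subset_trans)
  then have "x \<in> {E, T}" "y \<in> {E, T}" using xy(1,2) by (auto dest: subsetD)
  then have "{E, T} = {x} \<union> {y}" using xy(3) by auto
  then have Z1: "Z1 = {x} \<union> {y}" using sub xy(1,2) by (intro equalityI) simp_all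
  have "closedin (subtopology grass_zariski X) {x}" "closedin (subtopology grass_zariski X) {y}"
    using \<open>Z1 \<subseteq> X\<close> xy by (auto intro: closedin_grass_singleton[OF assms(1)])
  then have "{x} = Z1 \<or> {y} = Z1"
    using Z(2) Z1 unfolding irreducible_closedin_def by (elim conjE allE[of _ "{x}"] allE[of _ "{y}"]) simp
  then show False using xy by blast
qed

text \<open>
  The closure of the pencil is irreducible, because a closed set that contains infinitely many of
  its lines contains all of them; a single line is a smaller irreducible closed set.
\<close>

lemma krull_dim_ge_1_if_pencil:
  assumes X: "X \<subseteq> grass"
    and indep: "\<And>t. indep2 (u + t *s a) (v + t *s b)"
    and L: "\<And>t. L t = proj_of (vec.span {u + t *s a, v + t *s b})" "\<And>t. L t \<in> X"
    and ne: "L 0 \<noteq> L 1"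
  shows "krull_dim (subtopology grass_zariski X) \<ge> 1"
proof -
  let ?T = "subtopology grass_zariski X"
  have "topspace ?T = X"
    using X by (auto simp: grass_zariski_def topspace_pullback_topology topspace_zariski)
  have range: "L t \<in> A" if A: "closedin ?T A" "infinite {s. L s \<in> A}" for A t
  proof (rule ccontr)
    assume "L t \<notin> A"
    then obtain f :: "(1 \<Rightarrow> complex ^ (4 \<times> 4)) \<Rightarrow> complex" and d where f: "multihomogeneous d f"
      "f (\<lambda>_. rep_proj (pluecker (L t))) \<noteq> 0" "\<forall>T\<in>A. f (\<lambda>_. rep_proj (pluecker T)) = 0"
      using closedin_grass_separation[OF A(1) L(2) X] by blast
    define x where "x s = (\<lambda>_ :: 1. wedge (u + s *s a) (v + s *s b))" for s
    have coords: "homogeneous_coords (x s) (\<lambda>_. pluecker (L s))" for s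
    proof -
      obtain k where k: "k \<noteq> 0" "rep_proj (pluecker (L s)) = k *s wedge (u + s *s a) (v + s *s b)"
        using rep_proj_pluecker[OF indep] L(1) by metis
      then have "wedge (u + s *s a) (v + s *s b) = inverse k *s rep_proj (pluecker (L s))"
        by (simp add: vector_smult_assoc)
      then show ?thesis unfolding homogeneous_coords_def x_def using k(1) nonzero_imp_inverse_nonzero by blast
    qed
    have iff: "f (x s) = 0 \<longleftrightarrow> f (\<lambda>_. rep_proj (pluecker (L s))) = 0" for s
      by (rule multihomogeneous_coords_zero_iff[OF f(1) coords])
    have "poly_fun (\<lambda>s. x s i $ j)" for i j
      by (cases j) (simp add: x_def wedge_def,
        intro poly_fun_diff poly_fun_mult poly_fun_add poly_fun_const poly_fun_ident)
    then have "poly_fun (\<lambda>s. f (x s))" by (rule poly_fun_multihomogeneous[OF f(1)])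
    moreover have "infinite {s. f (x s) = 0}"
      using A(2) by (rule infinite_super[rotated]) (use f(3) iff in auto)
    ultimately show False using poly_fun_zero f(2) iff by blast
  qed
  let ?Z = "?T closure_of (range L)"
  have L_Z: "range L \<subseteq> ?Z"
    by (rule closure_of_subset) (use L(2) \<open>topspace ?T = X\<close> in auto)
  have irr: "irreducible_closedin ?T ?Z"
    unfolding irreducible_closedin_def
  proof (intro conjI allI impI)
    show "?Z \<noteq> {}" using L_Z by auto
    fix A B assume A: "closedin ?T A" and B: "closedin ?T B" and AB: "?Z = A \<union> B"
    have "{s. L s \<in> A} \<union> {s. L s \<in> B} = UNIV" using L_Z AB by auto
    then have "infinite {s. L s \<in> A} \<or> infinite {s. L s \<in> B}"
      using infinite_UNIV_char_0[where 'a = complex] by (metis finite_Un)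
    then have "range L \<subseteq> A \<or> range L \<subseteq> B" using range A B by blast
    then have "?Z \<subseteq> A \<or> ?Z \<subseteq> B" using closure_of_minimal A B by blast
    then show "A = ?Z \<or> B = ?Z" using AB by blast
  qed simp
  have irr0: "irreducible_closedin ?T {L 0}"
    unfolding irreducible_closedin_def using closedin_grass_singleton[OF X L(2)[of 0]] by blast
  have "{L 0} \<subset> ?Z" using L_Z ne by blast
  with irr0 irr show ?thesis by (rule krull_dim_ge_1I)
qed

section \<open>Cameras and back-projected planes\<close>

text \<open>
  The covector of the back-projected plane, that is, the column of \<open>M_matrix\<close>.
\<close>

definition plane :: "complex ^ 4 ^ 3 \<Rightarrow> 3 proj \<Rightarrow> complex ^ 4" where
  "plane C l = rep_proj l v* C"

lemma scalar_product_vector_matrix: "scalar_product (l v* C) x = scalar_product (C *v x) l"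
  for C :: "complex ^ 'n ^ 'm"
  using scalar_product_matrix[of l C x] by (simp add: scalar_product_commute)

lemma vector_matrix_add_smult: "(a *s l + m) v* C = a *s (l v* C) + m v* C" "(a *s l) v* C = a *s (l v* C)"
  for C :: "complex ^ 'n ^ 'm"
  by (simp_all add: vec_eq_iff vector_matrix_mult_def sum.distrib sum_distrib_left algebra_simps)

lemma pinhole_camera_left_inverse:
  assumes "pinhole_camera C"
  shows "\<exists>D. \<forall>l. D *v (l v* C) = l"
proof -
  have "vec.dim (columns C) = CARD(3)"
    using assms by (simp add: pinhole_camera_def flip: rank_eq_dim_columns)
  then have "vec.span (columns C) = UNIV"
    using vec.dim_eq_full[of "columns C"] by (simp add: vec.dimension_def card_cart_basis)
  then obtain B where "C ** B = mat 1"
    using matrix_right_invertible_span_columns by blast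
  then have "transpose B ** transpose C = mat 1"
    by (simp add: transpose_mat flip: matrix_transpose_mul)
  then have "transpose B *v (transpose C *v l) = l" for l
    by (simp only: matrix_vector_mul_assoc matrix_vector_mul_lid)
  then show ?thesis by (intro exI[of _ "transpose B"]) simp
qed

lemma matrix_kernel_iff: "C *v x = 0 \<longleftrightarrow> (\<forall>s\<in>rows C. scalar_product s x = 0)"
  for C :: "complex ^ 'n ^ 'm"
  by (auto simp: rows_def row_def vec_eq_iff scalar_product_def matrix_vector_mult_def)

lemma
  assumes "pinhole_camera C"
  shows center_kernel: "C *v rep_proj (center C) = 0"
    and kernel_center: "C *v x = 0 \<Longrightarrow> \<exists>a. x = a *s rep_proj (center C)"
proof -
  have dim: "vec.dim (rows C) = 3"
    using assms by (simp add: pinhole_camera_def row_rank_def_gen)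
  obtain y where y: "y \<noteq> 0" "C *v y = 0"
    using exists_orthogonal[of "rows C"] dim by (auto simp: matrix_kernel_iff)
  obtain a where a: "a \<noteq> 0" "rep_proj (abs_proj y) = a *s y"
    using rep_proj_abs_proj[OF y(1)] by blast
  have par: "\<exists>b. x = b *s z" if "z \<noteq> 0" "C *v z = 0" "C *v x = 0" for x z
    using orthogonal_unique[of "rows C" z x] that dim by (simp add: matrix_kernel_iff)
  have "\<exists>!c. C *v rep_proj c = 0"
  proof (rule ex1I)
    show "C *v rep_proj (abs_proj y) = 0" using y(2) by (simp add: a(2) vec.scale)
    fix c assume "C *v rep_proj c = 0"
    then have "\<exists>b. rep_proj c = b *s rep_proj (abs_proj y)"
      using par[OF rep_proj_nonzero \<open>C *v rep_proj (abs_proj y) = 0\<close>] by blast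
    then show "c = abs_proj y" using proj_eq_iff by metis
  qed
  then show c: "C *v rep_proj (center C) = 0"
    unfolding center_def by (rule theI')
  show "\<exists>a. x = a *s rep_proj (center C)" if "C *v x = 0"
    using par[OF rep_proj_nonzero c that] .
qed

lemma plane_center:
  assumes "pinhole_camera C"
  shows "scalar_product (plane C l) (rep_proj (center C)) = 0"
  by (simp add: plane_def scalar_product_vector_matrix center_kernel[OF assms])

lemma plane_nonzero:
  assumes "pinhole_camera C"
  shows "plane C l \<noteq> 0"
proof
  assume "plane C l = 0"
  moreover obtain D where "\<And>l. D *v (l v* C) = l"
    using pinhole_camera_left_inverse[OF assms] by blast
  ultimately show False
    using rep_proj_nonzero[of l] by (metis plane_def matrix_vector_mult_0_right)
qed

lemma plane_inj:
  assumes "pinhole_camera C" "plane C l' = a *s plane C l"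
  shows "l' = l"
proof -
  obtain D where D: "\<And>l. D *v (l v* C) = l"
    using pinhole_camera_left_inverse[OF assms(1)] by blast
  have "rep_proj l' = a *s rep_proj l"
    using arg_cong[OF assms(2), of "(*v) D"] by (simp add: plane_def D vec.scale)
  then have "l = l'" unfolding proj_eq_iff by blast
  then show ?thesis by simp
qed

text \<open>
  The range of the transposed camera matrix is the row space, which has dimension three and is
  orthogonal to the center; a vector outside it would leave no room for the center.
\<close>

lemma plane_surj:
  assumes "pinhole_camera C" "h \<noteq> 0" "scalar_product h (rep_proj (center C)) = 0"
  shows "\<exists>l a. a \<noteq> 0 \<and> plane C l = a *s h"
proof -
  let ?c = "rep_proj (center C)"
  have rows: "\<forall>s\<in>rows C. scalar_product s ?c = 0"
    using center_kernel[OF assms(1)] by (simp add: matrix_kernel_iff)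
  have "h \<in> vec.span (rows C)"
  proof (rule ccontr)
    assume "h \<notin> vec.span (rows C)"
    then have "vec.dim (insert h (rows C)) = CARD(4)"
      using assms(1) by (simp add: vec.dim_insert pinhole_camera_def row_rank_def_gen)
    then have "vec.span (insert h (rows C)) = UNIV"
      using vec.dim_eq_full[of "insert h (rows C)"] by (simp add: vec.dimension_def card_cart_basis)
    then have "scalar_product y ?c = 0" for y
      using scalar_product_span_zero[of "insert h (rows C)" ?c y] rows assms(3) by simp
    then have "?c = 0" using scalar_product_all_zero scalar_product_commute by metis
    then show False using rep_proj_nonzero by blast
  qed
  then have "h \<in> range (\<lambda>l. l v* C)"
  proof (rule vec.span_induct_alt)
    show "0 \<in> range (\<lambda>l. l v* C)"
      using vector_matrix_add_smult(2)[of 0 0 C] by (metis rangeI vec.scale_zero_left)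
    fix a x y assume "x \<in> rows C" "y \<in> range (\<lambda>l. l v* C)"
    then obtain r z where "x = row r C" "y = z v* C" by (auto simp: rows_def)
    moreover have "row r C = axis r 1 v* C"
      by (simp add: vec_eq_iff row_def vector_matrix_mult_def axis_def if_distrib if_distribR cong: if_cong)
    ultimately have "a *s x + y = (a *s axis r 1 + z) v* C"
      by (simp add: vector_matrix_add_smult)
    then show "a *s x + y \<in> range (\<lambda>l. l v* C)" by blast
  qed
  then obtain z where z: "h = z v* C" by blast
  have "z \<noteq> 0"
    using assms(2) vector_matrix_add_smult(2)[of 0 z C] by (auto simp: z)
  then obtain a where "a \<noteq> 0" "rep_proj (abs_proj z) = a *s z"
    using rep_proj_abs_proj by blast
  then have "plane C (abs_proj z) = a *s h"
    by (simp add: plane_def z vector_matrix_add_smult)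
  then show ?thesis using \<open>a \<noteq> 0\<close> by blast
qed

lemma span_eq_hyperplane:
  fixes u v l :: "complex ^ 3"
  assumes "indep2 u v" "l \<noteq> 0" "scalar_product u l = 0" "scalar_product v l = 0"
  shows "vec.span {u, v} = {z. scalar_product z l = 0}"
proof (rule vec.subspace_dim_equal)
  let ?H = "{z. scalar_product z l = 0}"
  show sub: "vec.subspace ?H" by (rule vec.subspaceI) (simp_all add: scalar_product_simps)
  show "vec.span {u, v} \<subseteq> ?H"
    using assms by (intro vec.span_minimal sub) auto
  have "vec.dim ?H \<noteq> CARD(3)"
  proof
    assume "vec.dim ?H = CARD(3)"
    then have "vec.span ?H = UNIV"
      using vec.dim_eq_full[of ?H] by (simp add: vec.dimension_def card_cart_basis)
    then have "?H = UNIV" using vec.span_eq_iff[THEN iffD2, OF sub] by (rule trans[OF sym, rotated])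
    then have "scalar_product z l = 0" for z by (simp add: set_eq_iff)
    then have "scalar_product l z = 0" for z by (subst scalar_product_commute)
    then show False using assms(2) scalar_product_all_zero by blast
  qed
  then show "vec.dim ?H \<le> vec.dim (vec.span {u, v})"
    using assms(1) vec.dim_subset_UNIV[of ?H] by (simp add: dim_2_iff[symmetric] vec.dimension_def card_cart_basis)
qed auto

lemma orthogonal_span_iff: "(\<forall>z\<in>vec.span S. scalar_product h z = 0) \<longleftrightarrow> (\<forall>z\<in>S. scalar_product h z = 0)"
  for h :: "complex ^ 'n"
proof
  assume "\<forall>z\<in>S. scalar_product h z = 0"
  then have "\<forall>z\<in>S. scalar_product z h = 0" by (subst scalar_product_commute)
  then have "scalar_product z h = 0" if "z \<in> vec.span S" for z
    using that by (rule scalar_product_span_zero)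
  then show "\<forall>z\<in>vec.span S. scalar_product h z = 0" by (subst scalar_product_commute) blast
qed (simp add: vec.span_base)

text \<open>
  The covectors of the planes through the line and the center are proportional to
  \<open>vol u v c\<close>, so orthogonality to \<open>u\<close> and \<open>v\<close> determines the image line, which is therefore
  the one that the definite description denotes.
\<close>

lemma cam_line_eqI:
  assumes C: "pinhole_camera C" and uv: "indep2 u v" and c: "rep_proj (center C) \<notin> vec.span {u, v}"
    and l: "scalar_product (plane C l) u = 0" "scalar_product (plane C l) v = 0"
  shows "cam_line C (proj_of (vec.span {u, v})) = l"
proof -
  let ?c = "rep_proj (center C)" let ?L = "proj_of (vec.span {u, v})"
  have vol: "vol u v ?c \<noteq> 0" using uv c by (simp add: vol_nonzero_iff)
  have uniq: "l' = l" if l': "scalar_product (plane C l') u = 0" "scalar_product (plane C l') v = 0" for l'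
  proof -
    obtain s where s: "plane C l = s *s vol u v ?c"
      using vol_unique[OF vol, of "plane C l"] l plane_center[OF C, of l] by (auto simp: scalar_product_commute)
    obtain s' where s': "plane C l' = s' *s vol u v ?c"
      using vol_unique[OF vol, of "plane C l'"] l' plane_center[OF C, of l'] by (auto simp: scalar_product_commute)
    have "s \<noteq> 0" using s plane_nonzero[OF C, of l] by auto
    then have "plane C l' = (s' / s) *s plane C l" by (simp add: s s' vector_smult_assoc)
    then show ?thesis using plane_inj[OF C] by blast
  qed
  have iff: "line_of_equation l' = proj_span {cam_point C x, cam_point C y} \<longleftrightarrow>
      scalar_product (plane C l') u = 0 \<and> scalar_product (plane C l') v = 0"
    if "x \<in> ?L" "y \<in> ?L" "x \<noteq> y" for x y l'
  proof -
    let ?x = "rep_proj x" and ?y = "rep_proj y"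
    have xy: "indep2 ?x ?y" "?x \<in> vec.span {u, v}" "?y \<in> vec.span {u, v}"
      using that by (simp_all add: proj_neq_iff proj_of_def)
    have span: "vec.span {?x, ?y} = vec.span {u, v}" by (rule span_pair_eq[OF uv xy])
    have ind: "indep2 (C *v ?x) (C *v ?y)"
      unfolding indep2_def
    proof (intro allI impI)
      fix a b assume "a *s (C *v ?x) + b *s (C *v ?y) = 0"
      then have "C *v (a *s ?x + b *s ?y) = 0" by (simp add: vec.scale vec.add)
      then obtain k where k: "a *s ?x + b *s ?y = k *s ?c" using kernel_center[OF C] by blast
      have "k = 0"
      proof (rule ccontr)
        assume "k \<noteq> 0"
        then have "?c = inverse k *s (a *s ?x + b *s ?y)" by (simp add: k vector_smult_assoc)
        then have "?c \<in> vec.span {?x, ?y}"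
          by (simp add: vec.span_scale vec.span_add vec.span_base)
        then show False using c span by simp
      qed
      then show "a = 0 \<and> b = 0" using k xy(1) by (simp add: indep2_def)
    qed
    obtain a where a: "a \<noteq> 0" "rep_proj (cam_point C x) = a *s (C *v ?x)"
      unfolding cam_point_def using rep_proj_abs_proj indep2_nonzero(1)[OF ind] by blast
    obtain b where b: "b \<noteq> 0" "rep_proj (cam_point C y) = b *s (C *v ?y)"
      unfolding cam_point_def using rep_proj_abs_proj indep2_nonzero(2)[OF ind] by blast
    have span_eq: "proj_span {cam_point C x, cam_point C y} = proj_of (vec.span {C *v ?x, C *v ?y})"
      by (simp add: proj_span_eq a b span_pair_smult)
    let ?H = "{z. scalar_product z (rep_proj l') = 0}"
    have H: "line_of_equation l' = proj_of ?H" by (simp add: line_of_equation_def proj_of_def)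
    have subH: "vec.subspace ?H" by (rule vec.subspaceI) (simp_all add: scalar_product_simps)
    have plane_zero: "scalar_product (C *v z) (rep_proj l') = scalar_product (plane C l') z" for z
      by (simp add: plane_def scalar_product_vector_matrix)
    have "line_of_equation l' = proj_span {cam_point C x, cam_point C y} \<longleftrightarrow>
      scalar_product (plane C l') ?x = 0 \<and> scalar_product (plane C l') ?y = 0" (is "?l \<longleftrightarrow> ?r")
    proof
      assume ?l
      then have "vec.span {C *v ?x, C *v ?y} \<subseteq> ?H"
        using proj_of_mono_iff[OF vec.subspace_span subH, of "{C *v ?x, C *v ?y}"] unfolding H span_eq by simp
      then have "C *v ?x \<in> ?H" "C *v ?y \<in> ?H"
        using vec.span_superset[of "{C *v ?x, C *v ?y}"] by blast+
      then show ?r by (simp add: plane_zero)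
    next
      assume ?r
      then show ?l
        unfolding H span_eq using span_eq_hyperplane[OF ind rep_proj_nonzero[of l']]
        by (simp add: plane_zero)
    qed
    also have "\<dots> \<longleftrightarrow> (\<forall>z\<in>vec.span {?x, ?y}. scalar_product (plane C l') z = 0)"
      unfolding orthogonal_span_iff by simp
    also have "\<dots> \<longleftrightarrow> scalar_product (plane C l') u = 0 \<and> scalar_product (plane C l') v = 0"
      unfolding span orthogonal_span_iff by simp
    finally show ?thesis .
  qed
  have "?L \<in> grass" using uv grass_iff by blast
  then obtain x y where "x \<noteq> y" and L: "?L = proj_span {x, y}"
    unfolding grass_def is_line_def by blast
  moreover have "x \<in> ?L" "y \<in> ?L"
    unfolding L by (simp_all add: proj_span_def vec.span_base)
  ultimately have xy: "x \<in> ?L" "y \<in> ?L" "x \<noteq> y" by simp_all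
  show ?thesis
    unfolding cam_line_def
  proof (rule the_equality)
    show "\<exists>x\<in>?L. \<exists>y\<in>?L. x \<noteq> y \<and> line_of_equation l = proj_span {cam_point C x, cam_point C y}"
      using xy iff[OF xy] l by blast
  qed (use iff uniq in blast)
qed

lemma joint_camera_image_iff:
  fixes C :: "'m \<Rightarrow> complex ^ 4 ^ 3"
  assumes C: "\<And>i. pinhole_camera (C i)"
  shows "p \<in> joint_camera_image C \<longleftrightarrow> (\<exists>u v. indep2 u v \<and> (\<forall>i. rep_proj (center (C i)) \<notin> vec.span {u, v} \<and>
    scalar_product (plane (C i) (p i)) u = 0 \<and> scalar_product (plane (C i) (p i)) v = 0))"
    (is "_ \<longleftrightarrow> ?r")
proof
  assume "p \<in> joint_camera_image C"
  then obtain L where L: "L \<in> grass" "\<forall>i. center (C i) \<notin> L" "p = joint_camera_map C L"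
    unfolding joint_camera_image_def by blast
  then obtain u v where uv: "indep2 u v" "L = proj_of (vec.span {u, v})" using grass_iff by blast
  have c: "rep_proj (center (C i)) \<notin> vec.span {u, v}" for i
    using L(2) uv(2) by (simp add: proj_of_def)
  have "scalar_product (plane (C i) (p i)) u = 0 \<and> scalar_product (plane (C i) (p i)) v = 0" for i
  proof -
    let ?V = "vol u v (rep_proj (center (C i)))"
    have "?V \<noteq> 0" using c uv(1) by (simp add: vol_nonzero_iff)
    then obtain l a where l: "plane (C i) l = a *s ?V"
      using plane_surj[OF C] vol_orthogonal(3) by blast
    then have "cam_line (C i) L = l"
      unfolding uv(2)
      by (intro cam_line_eqI[OF C uv(1) c]) (simp_all add: scalar_product_smult vol_orthogonal)
    then show ?thesis
      by (simp add: L(3) joint_camera_map_def l scalar_product_smult vol_orthogonal)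
  qed
  then show ?r using uv(1) c by blast
next
  assume ?r
  then obtain u v where uv: "indep2 u v" "\<And>i. rep_proj (center (C i)) \<notin> vec.span {u, v}"
    "\<And>i. scalar_product (plane (C i) (p i)) u = 0" "\<And>i. scalar_product (plane (C i) (p i)) v = 0"
    by blast
  let ?L = "proj_of (vec.span {u, v})"
  have "p = joint_camera_map C ?L"
    unfolding joint_camera_map_def using cam_line_eqI[OF C uv(1,2,3,4)] by (intro ext) simp
  moreover have "?L \<in> grass" "\<forall>i. center (C i) \<notin> ?L"
    using uv grass_iff by (auto simp: proj_of_def)
  ultimately show "p \<in> joint_camera_image C"
    unfolding joint_camera_image_def by blast
qed

section \<open>The incidence conditions in terms of vectors\<close>

lemma conj_dual_proj_of:
  assumes "vec.subspace E"
  shows "conj_dual (proj_of E) = proj_of (conj_complement E)"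
proof -
  have "(\<forall>q\<in>proj_of E. scalar_product x (rep_proj q) = 0) \<longleftrightarrow> (\<forall>q\<in>E. scalar_product x q = 0)" for x
  proof
    assume l: "\<forall>q\<in>proj_of E. scalar_product x (rep_proj q) = 0"
    show "\<forall>q\<in>E. scalar_product x q = 0"
    proof
      fix q assume q: "q \<in> E"
      show "scalar_product x q = 0"
      proof (cases "q = 0")
        case False
        then obtain a where a: "a \<noteq> 0" "rep_proj (abs_proj q) = a *s q"
          using rep_proj_abs_proj[OF False] by blast
        have "abs_proj q \<in> proj_of E" using abs_proj_in_proj_of[OF assms False] q by simp
        then have "scalar_product x (rep_proj (abs_proj q)) = 0" by (rule l[THEN bspec])
        then show ?thesis using a by (simp add: scalar_product_smult)
      qed simp
    qed
  qed (simp add: proj_of_def)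
  then show ?thesis
    by (auto simp: conj_dual_def proj_of_def conj_complement_def)
qed

lemma F_space_eq:
  assumes E: "center_span C I = proj_of E" "vec.subspace E"
  shows "F_space C I i l = proj_of {x. \<exists>a w. x = a *s rep_proj (center (C i)) + w \<and>
    w \<in> conj_complement E \<and> scalar_product (plane (C i) l) w = 0}"
    (is "_ = proj_of ?F")
proof -
  let ?c = "rep_proj (center (C i))"
  let ?N = "{w. w \<in> conj_complement E \<and> scalar_product (plane (C i) l) w = 0}"
  have subN: "vec.subspace ?N"
    by (rule vec.subspaceI)
       (auto simp: scalar_product_simps vec.subspace_add vec.subspace_scale vec.subspace_0 subspace_conj_complement)
  have "back_plane (C i) l = proj_of {w. scalar_product (plane (C i) l) w = 0}"
    unfolding back_plane_def plane_def proj_of_def by (simp add: scalar_product_commute)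
  then have N: "back_plane (C i) l \<inter> conj_dual (center_span C I) = proj_of ?N"
    unfolding E(1) conj_dual_proj_of[OF E(2)] by (auto simp: proj_of_def)
  have span_N: "vec.span (rep_proj ` proj_of ?N) = ?N"
  proof
    show "vec.span (rep_proj ` proj_of ?N) \<subseteq> ?N"
      by (rule vec.span_minimal[OF _ subN]) (auto simp: proj_of_def)
    show "?N \<subseteq> vec.span (rep_proj ` proj_of ?N)"
    proof
      fix w assume w: "w \<in> ?N"
      show "w \<in> vec.span (rep_proj ` proj_of ?N)"
      proof (cases "w = 0")
        case False
        then obtain a where a: "a \<noteq> 0" "rep_proj (abs_proj w) = a *s w"
          using rep_proj_abs_proj[OF False] by blast
        then have eq: "inverse a *s rep_proj (abs_proj w) = w" by (simp add: vector_smult_assoc)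
        have "abs_proj w \<in> proj_of ?N" using abs_proj_in_proj_of[OF subN False] w by blast
        then have "inverse a *s rep_proj (abs_proj w) \<in> vec.span (rep_proj ` proj_of ?N)"
          by (intro vec.span_scale vec.span_base imageI)
        then show ?thesis unfolding eq .
      qed (simp add: vec.span_zero)
    qed
  qed
  have "vec.span (rep_proj ` ({center (C i)} \<union> proj_of ?N)) = {x + y | x y. x \<in> vec.span {?c} \<and> y \<in> ?N}"
    unfolding image_Un vec.span_Un span_N by simp
  also have "\<dots> = ?F" by (auto simp: vec.span_singleton)
  finally show ?thesis unfolding F_space_def N proj_span_eq by simp
qed

lemma in_Omega_iff:
  assumes E: "center_span C I = proj_of E" "vec.subspace E" and uv: "indep2 u v"
  shows "proj_of (vec.span {u, v}) \<in> Omega C I i l \<longleftrightarrow>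
    (\<exists>x a w. x \<noteq> 0 \<and> x \<in> vec.span {u, v} \<and> x = a *s rep_proj (center (C i)) + w \<and>
      w \<in> conj_complement E \<and> scalar_product (plane (C i) l) w = 0)"
proof -
  let ?c = "rep_proj (center (C i))"
  let ?F = "{x. \<exists>a w. x = a *s ?c + w \<and> w \<in> conj_complement E \<and> scalar_product (plane (C i) l) w = 0}"
  have subF: "vec.subspace ?F"
  proof (rule vec.subspaceI)
    show "0 \<in> ?F" using subspace_conj_complement[of E]
      by (auto intro!: exI[of _ 0] simp: vec.subspace_0)
    fix x k assume "x \<in> ?F"
    then obtain a w where x: "x = a *s ?c + w" "w \<in> conj_complement E" "scalar_product (plane (C i) l) w = 0" by blast
    then have "k *s x = (k * a) *s ?c + k *s w" "k *s w \<in> conj_complement E" "scalar_product (plane (C i) l) (k *s w) = 0"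
      by (simp_all add: vec.scale_right_distrib vec.subspace_scale subspace_conj_complement scalar_product_simps)
    then show "k *s x \<in> ?F" by blast
    fix y assume "y \<in> ?F"
    then obtain b z where y: "y = b *s ?c + z" "z \<in> conj_complement E" "scalar_product (plane (C i) l) z = 0" by blast
    then have "x + y = (a + b) *s ?c + (w + z)" "w + z \<in> conj_complement E" "scalar_product (plane (C i) l) (w + z) = 0"
      using x by (simp_all add: vec.scale_left_distrib vec.subspace_add subspace_conj_complement scalar_product_simps)
    then show "x + y \<in> ?F" by blast
  qed
  have "proj_of (vec.span {u, v}) \<in> grass" using uv grass_iff by blast
  then have "proj_of (vec.span {u, v}) \<in> Omega C I i l \<longleftrightarrow> (\<exists>x. x \<noteq> 0 \<and> x \<in> vec.span {u, v} \<and> x \<in> ?F)"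
    unfolding Omega_def F_space_eq[OF E] using proj_of_meet_iff[OF vec.subspace_span subF] by simp
  then show ?thesis by auto
qed

section \<open>Solvability of linear systems is a closed condition\<close>

text \<open>
  The condition is the vanishing of the determinants of all quadruples of rows; each of them is
  multihomogeneous, because each row is.
\<close>

lemma common_orthogonal_closed:
  fixes r :: "'s \<Rightarrow> ('m::finite \<Rightarrow> complex ^ 'n::finite) \<Rightarrow> complex ^ 4"
  assumes r: "\<And>s k. s \<in> S \<Longrightarrow> multihomogeneous (d s) (\<lambda>x. r s x $ k)"
    and Q: "\<And>q. q \<in> Q \<Longrightarrow> \<exists>y. y \<noteq> 0 \<and> (\<forall>s\<in>S. scalar_product (r s (\<lambda>i. rep_proj (q i))) y = 0)"
    and p: "p \<in> zariski closure_of Q"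
  shows "\<exists>y. y \<noteq> 0 \<and> (\<forall>s\<in>S. scalar_product (r s (\<lambda>i. rep_proj (p i))) y = 0)"
proof -
  have iff: "(\<exists>y. y \<noteq> 0 \<and> (\<forall>s\<in>S. scalar_product (r s x) y = 0)) \<longleftrightarrow>
    (\<forall>a\<in>S. \<forall>b\<in>S. \<forall>c\<in>S. \<forall>e\<in>S. scalar_product (vol (r a x) (r b x) (r c x)) (r e x) = 0)" for x
    using common_orthogonal_iff[of "(\<lambda>s. r s x) ` S"] by simp
  show ?thesis
    unfolding iff
  proof (intro ballI)
    fix a b c e assume S: "a \<in> S" "b \<in> S" "c \<in> S" "e \<in> S"
    let ?D = "\<lambda>i. d a i + (d b i + d c i)"
    have minor: "multihomogeneous ?D (\<lambda>x. minor3 (r a x) (r b x) (r c x) i j k)" for i j k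
      unfolding minor3_def
      by (intro multihomogeneous_add multihomogeneous_diff multihomogeneous_mult r S)
    have uminus: "multihomogeneous ?D (\<lambda>x. - minor3 (r a x) (r b x) (r c x) i j k)" for i j k
      using multihomogeneous_cmult[OF minor, of "-1" i j k] by simp
    have "multihomogeneous (\<lambda>i. ?D i + d e i) (\<lambda>x. scalar_product (vol (r a x) (r b x) (r c x)) (r e x))"
      unfolding scalar_product_def sum_4 vol_nth
      by (intro multihomogeneous_add multihomogeneous_mult minor uminus r S)
    from closure_of_zariski_vanish[OF p this]
    show "scalar_product (vol (r a (\<lambda>i. rep_proj (p i))) (r b (\<lambda>i. rep_proj (p i))) (r c (\<lambda>i. rep_proj (p i))))
        (r e (\<lambda>i. rep_proj (p i))) = 0"
      using Q iff S by blast
  qed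
qed

section \<open>Transversals as graphs\<close>

locale skew_lines =
  fixes e1 e2 w1 w2 :: "complex ^ 4"
  assumes indep_e: "indep2 e1 e2" and indep_w: "indep2 w1 w2"
    and disjoint: "x \<in> vec.span {e1, e2} \<Longrightarrow> x \<in> vec.span {w1, w2} \<Longrightarrow> x = 0"
    and decompose: "\<exists>e\<in>vec.span {e1, e2}. \<exists>w\<in>vec.span {w1, w2}. x = e + w"
begin

abbreviation "E \<equiv> vec.span {e1, e2}"
abbreviation "W \<equiv> vec.span {w1, w2}"

lemma sum_unique:
  assumes "e + w = e' + w'" "e \<in> E" "e' \<in> E" "w \<in> W" "w' \<in> W"
  shows "e = e'" "w = w'"
proof -
  have eq: "e - e' = w' - w" using assms(1) by (simp add: algebra_simps)
  have "e - e' \<in> E" "w' - w \<in> W" using assms by (auto intro: vec.span_diff)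
  then have "e - e' = 0" by (intro disjoint) (simp_all only: eq)
  then show "e = e'" by simp
  then show "w = w'" using assms(1) by simp
qed

lemma coefficients_unique:
  assumes "a *s e1 + b *s e2 = a' *s e1 + b' *s e2"
  shows "a = a'" "b = b'"
proof -
  have "(a - a') *s e1 + (b - b') *s e2 = 0"
    using assms by (simp add: vec.scale_left_diff_distrib algebra_simps)
  then have "a - a' = 0 \<and> b - b' = 0" using indep_e unfolding indep2_def by blast
  then show "a = a'" "b = b'" by simp_all
qed

lemma e_in_E: "a *s e1 + b *s e2 \<in> E"
  unfolding in_span_2 by blast

lemma combination_in_W: "f1 \<in> W \<Longrightarrow> f2 \<in> W \<Longrightarrow> a *s f1 + b *s f2 \<in> W"
  by (intro vec.span_add vec.span_scale)

lemma graph_indep: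
  assumes "f1 \<in> W" "f2 \<in> W"
  shows "indep2 (e1 + f1) (e2 + f2)"
  unfolding indep2_def
proof (intro allI impI)
  fix a b assume "a *s (e1 + f1) + b *s (e2 + f2) = 0"
  then have "(a *s e1 + b *s e2) + (a *s f1 + b *s f2) = (0 *s e1 + 0 *s e2) + 0"
    by (simp add: vec.scale_right_distrib algebra_simps)
  then have "a *s e1 + b *s e2 = 0 *s e1 + 0 *s e2"
    by (rule sum_unique(1)) (use assms in \<open>auto intro: e_in_E combination_in_W vec.span_zero simp del: vec.scale_zero_left\<close>)
  then show "a = 0 \<and> b = 0" using coefficients_unique by blast
qed

text \<open>
  The linear map \<open>\<phi>\<close> with \<open>e1 \<mapsto> f1\<close> and \<open>e2 \<mapsto> f2\<close> maps \<open>c i\<close> to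
  \<open>\<alpha> i *s f1 + \<beta> i *s f2\<close>.  If the transversal \<open>T\<close> is disjoint from \<open>W\<close>, it is the graph of
  \<open>\<phi>\<close>.  If \<open>T\<close> contains a point \<open>z\<close> of \<open>W\<close>, let \<open>\<phi>\<close> have image \<open>z\<close> and kill the
  \<open>E\<close>-component of a further point of \<open>T\<close>: for each \<open>i\<close>, either \<open>T\<close> meets the \<open>i\<close>-th space
  in \<open>z\<close>, or that component is proportional to \<open>c i\<close>.
\<close>

lemma third_transversal:
  fixes c h :: "'i \<Rightarrow> complex ^ 4" and \<alpha> \<beta> :: "'i \<Rightarrow> complex"
  assumes uv: "indep2 u v" and E: "vec.span {u, v} \<noteq> E" and W: "vec.span {u, v} \<noteq> W"
    and c: "\<And>i. i \<in> I \<Longrightarrow> c i = \<alpha> i *s e1 + \<beta> i *s e2"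
    and meet: "\<And>i. i \<in> I \<Longrightarrow> \<exists>x a w. x \<noteq> 0 \<and> x \<in> vec.span {u, v} \<and> x = a *s c i + w \<and> w \<in> W \<and> scalar_product (h i) w = 0"
  shows "\<exists>f1\<in>W. \<exists>f2\<in>W. \<not> (f1 = 0 \<and> f2 = 0) \<and> (\<forall>i\<in>I. scalar_product (h i) (\<alpha> i *s f1 + \<beta> i *s f2) = 0)"
proof (cases "\<exists>z. z \<noteq> 0 \<and> z \<in> vec.span {u, v} \<and> z \<in> W")
  case True
  then obtain z where z: "z \<noteq> 0" "z \<in> vec.span {u, v}" "z \<in> W" by blast
  have "\<not> {u, v} \<subseteq> W"
    using span_pair_eq[OF indep_w uv] W by auto
  then obtain y where y: "y \<in> vec.span {u, v}" "y \<notin> W"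
    using vec.span_superset[of "{u, v}"] by blast
  obtain e w where ew: "e \<in> E" "w \<in> W" "y = e + w" using decompose by blast
  obtain p q where pq: "e = p *s e1 + q *s e2" using ew(1) by (auto simp: in_span_2)
  have pq0: "\<not> (p = 0 \<and> q = 0)" using y(2) ew(2,3) pq by auto
  have "y \<noteq> k *s z" for k using y(2) z(3) vec.span_scale by blast
  then have "indep2 z y" using z(1) by (simp add: indep2_iff)
  then have span: "vec.span {z, y} = vec.span {u, v}" using span_pair_eq[OF uv] z(2) y(1) by blast
  \<comment> \<open>The map \<open>e1 \<mapsto> q z\<close>, \<open>e2 \<mapsto> - p z\<close> kills \<open>e = p e1 + q e2\<close>.\<close>
  have "scalar_product (h i) (\<alpha> i *s (q *s z) + \<beta> i *s ((- p) *s z)) = 0" if i: "i \<in> I" for i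
  proof -
    obtain x a w' where x: "x \<noteq> 0" "x \<in> vec.span {u, v}" "x = a *s c i + w'" "w' \<in> W" "scalar_product (h i) w' = 0"
      using meet[OF i] by blast
    have "x \<in> vec.span {z, y}" using x(2) span by simp
    then obtain s t where st: "x = s *s z + t *s y" unfolding in_span_2 by blast
    have "((t * p) *s e1 + (t * q) *s e2) + (s *s z + t *s w) = ((a * \<alpha> i) *s e1 + (a * \<beta> i) *s e2) + w'"
      using x(3) st c[OF i] ew(3) pq by (simp add: vec.scale_right_distrib vector_smult_assoc algebra_simps)
    note eq = this and un = sum_unique[OF this e_in_E e_in_E combination_in_W[OF z(3) ew(2)] x(4)]
    have ab: "t * p = a * \<alpha> i" "t * q = a * \<beta> i" using coefficients_unique[OF un(1)] by simp_all
    show ?thesis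
    proof (cases "t = 0")
      case True
      then have "w' = s *s z" using un(2) by simp
      moreover have "s \<noteq> 0" using x(1) st True by auto
      ultimately have "scalar_product (h i) z = 0" using x(5) by (simp add: scalar_product_smult)
      then show ?thesis by (simp add: scalar_product_simps)
    next
      case False
      then have "a \<noteq> 0" using ab pq0 by auto
      have "a * (\<alpha> i * q - \<beta> i * p) = t * p * q - t * q * p" unfolding ab by (simp add: algebra_simps)
      then have "\<alpha> i * q - \<beta> i * p = 0" using \<open>a \<noteq> 0\<close> by simp
      moreover have "\<alpha> i *s (q *s z) + \<beta> i *s ((- p) *s z) = (\<alpha> i * q - \<beta> i * p) *s z"
        by (simp add: vector_smult_assoc vec.scale_left_diff_distrib)
      ultimately show ?thesis by simp
    qed
  qed
  moreover have "q *s z \<in> W" "(- p) *s z \<in> W" using z(3) by (auto intro: vec.span_scale vec.span_neg)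
  moreover have "\<not> (q *s z = 0 \<and> (- p) *s z = 0)" using pq0 z(1) by auto
  ultimately show ?thesis by blast
next
  case False
  obtain eu wu where u: "eu \<in> E" "wu \<in> W" "u = eu + wu" using decompose by blast
  obtain ev wv where v: "ev \<in> E" "wv \<in> W" "v = ev + wv" using decompose by blast
  have "indep2 eu ev"
    unfolding indep2_def
  proof (intro allI impI)
    fix a b assume 0: "a *s eu + b *s ev = 0"
    have "a *s u + b *s v = (a *s eu + b *s ev) + (a *s wu + b *s wv)"
      unfolding u(3) v(3) by (simp add: vec.scale_right_distrib)
    then have "a *s u + b *s v \<in> W" using 0 combination_in_W[OF u(2) v(2)] by simp
    moreover have "a *s u + b *s v \<in> vec.span {u, v}" unfolding in_span_2 by blast
    ultimately have "a *s u + b *s v = 0" using False by blast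
    then show "a = 0 \<and> b = 0" using uv unfolding indep2_def by blast
  qed
  then have span: "vec.span {eu, ev} = E" using span_pair_eq[OF indep_e] u(1) v(1) by blast
  have lift: "\<exists>f\<in>W. e + f \<in> vec.span {u, v}" if "e \<in> E" for e
  proof -
    have "e \<in> vec.span {eu, ev}" using that span by simp
    then obtain a b where ab: "e = a *s eu + b *s ev" unfolding in_span_2 by blast
    have "e + (a *s wu + b *s wv) = a *s u + b *s v"
      unfolding u(3) v(3) ab by (simp add: vec.scale_right_distrib)
    then have "e + (a *s wu + b *s wv) \<in> vec.span {u, v}" unfolding in_span_2 by blast
    then show ?thesis using combination_in_W[OF u(2) v(2)] by blast
  qed
  obtain f1 where f1: "f1 \<in> W" "e1 + f1 \<in> vec.span {u, v}" using lift[of e1] by (auto simp: vec.span_base)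
  obtain f2 where f2: "f2 \<in> W" "e2 + f2 \<in> vec.span {u, v}" using lift[of e2] by (auto simp: vec.span_base)
  have T: "vec.span {e1 + f1, e2 + f2} = vec.span {u, v}"
    by (rule span_pair_eq[OF uv graph_indep[OF f1(1) f2(1)] f1(2) f2(2)])
  have "\<not> (f1 = 0 \<and> f2 = 0)"
  proof
    assume "f1 = 0 \<and> f2 = 0"
    then have "E = vec.span {e1 + f1, e2 + f2}" by simp
    then show False using E unfolding T by simp
  qed
  moreover have "scalar_product (h i) (\<alpha> i *s f1 + \<beta> i *s f2) = 0" if i: "i \<in> I" for i
  proof -
    obtain x a w where x: "x \<noteq> 0" "x \<in> vec.span {u, v}" "x = a *s c i + w" "w \<in> W" "scalar_product (h i) w = 0"
      using meet[OF i] by blast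
    have "x \<in> vec.span {e1 + f1, e2 + f2}" using x(2) T by simp
    then obtain p q where pq: "x = p *s (e1 + f1) + q *s (e2 + f2)" unfolding in_span_2 by blast
    have "(p *s e1 + q *s e2) + (p *s f1 + q *s f2) = ((a * \<alpha> i) *s e1 + (a * \<beta> i) *s e2) + w"
      using x(3) pq c[OF i] by (simp add: vec.scale_right_distrib vector_smult_assoc algebra_simps)
    note un = sum_unique[OF this e_in_E e_in_E combination_in_W[OF f1(1) f2(1)] x(4)]
    have ab: "p = a * \<alpha> i" "q = a * \<beta> i" using coefficients_unique[OF un(1)] by simp_all
    have "a \<noteq> 0" using ab pq x(1) by auto
    have w: "w = a *s (\<alpha> i *s f1 + \<beta> i *s f2)"
      unfolding un(2)[symmetric] ab by (simp add: vec.scale_right_distrib vector_smult_assoc)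
    have "a * scalar_product (h i) (\<alpha> i *s f1 + \<beta> i *s f2) = 0"
      using x(5) unfolding w scalar_product_smult(2) .
    then show ?thesis using \<open>a \<noteq> 0\<close> by simp
  qed
  ultimately show ?thesis using f1(1) f2(1) by blast
qed

text \<open>
  The graphs of the multiples of a nonzero map; they are not all equal, since a common value would
  put the image of the map into both skew lines.
\<close>

lemma graph_pencil:
  assumes f: "f1 \<in> W" "f2 \<in> W" "\<not> (f1 = 0 \<and> f2 = 0)"
    and X: "X \<subseteq> grass" "\<And>t. proj_of (vec.span {e1 + t *s f1, e2 + t *s f2}) \<in> X"
  shows "krull_dim (subtopology grass_zariski X) \<ge> 1"
proof (rule krull_dim_ge_1_if_pencil[OF X(1) _ refl X(2)])
  show "indep2 (e1 + t *s f1) (e2 + t *s f2)" for t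
    by (intro graph_indep vec.span_scale f)
  show "proj_of (vec.span {e1 + 0 *s f1, e2 + 0 *s f2}) \<noteq> proj_of (vec.span {e1 + 1 *s f1, e2 + 1 *s f2})"
  proof
    assume "proj_of (vec.span {e1 + 0 *s f1, e2 + 0 *s f2}) = proj_of (vec.span {e1 + 1 *s f1, e2 + 1 *s f2})"
    then have "vec.span {e1 + f1, e2 + f2} \<subseteq> E"
      using proj_of_mono_iff[of "vec.span {e1 + f1, e2 + f2}" E] by simp
    then have "e1 + f1 \<in> E" "e2 + f2 \<in> E"
      using vec.span_superset[of "{e1 + f1, e2 + f2}"] by blast+
    then have "(e1 + f1) - e1 \<in> E" "(e2 + f2) - e2 \<in> E"
      by (simp_all only: vec.span_diff vec.span_base insertI1 insertI2)
    then show False using disjoint f by simp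
  qed
qed

end

section \<open>Deformations of a line in the back-projected planes\<close>

lemma vol_cycle: "vol a b c = vol c a b"
  by (simp add: vec_eq_iff forall_4 vol_nth minor3_def algebra_simps)

lemma poly_vector_finite_zeros:
  assumes "\<And>k. poly_fun (\<lambda>t. v t $ k)" "v s \<noteq> 0"
  shows "finite {t. v t = 0}"
proof (rule ccontr)
  assume inf: "infinite {t. v t = 0}"
  obtain k where k: "v s $ k \<noteq> 0" using assms(2) by (auto simp: vec_eq_iff)
  have "infinite {t. v t $ k = 0}"
    using inf by (rule infinite_super[rotated]) auto
  then show False using poly_fun_zero[OF assms(1)] k by blast
qed

lemma poly_fun_vol:
  assumes "\<And>k. poly_fun (\<lambda>t. a t $ k)" "\<And>k. poly_fun (\<lambda>t. b t $ k)" "\<And>k. poly_fun (\<lambda>t. c t $ k)"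
  shows "poly_fun (\<lambda>t. vol (a t) (b t) (c t) $ k)"
proof -
  have m: "poly_fun (\<lambda>t. minor3 (a t) (b t) (c t) i j l)" for i j l
    unfolding minor3_def by (intro poly_fun_add poly_fun_diff poly_fun_mult assms)
  have um: "poly_fun (\<lambda>t. - minor3 (a t) (b t) (c t) i j l)" for i j l
    using poly_fun_mult[OF poly_fun_const[of "-1"] m] by simp
  have "\<forall>k. poly_fun (\<lambda>t. vol (a t) (b t) (c t) $ k)"
    unfolding forall_4 vol_nth using m um by blast
  then show ?thesis by blast
qed

lemma poly_fun_line: "poly_fun (\<lambda>t. (u + t *s v) $ k)"
  by simp (intro poly_fun_add poly_fun_mult poly_fun_const poly_fun_ident)

lemma poly_fun_matrix:
  assumes "\<And>k. poly_fun (\<lambda>t. v t $ k)"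
  shows "poly_fun (\<lambda>t. (D *v v t) $ j)"
  unfolding matrix_vector_mult_def by simp (intro poly_fun_sum poly_fun_mult poly_fun_const assms)

lemma coordinates_of_plane:
  assumes D: "\<And>l. D *v (l v* C) = l" and l: "plane C l = k *s x" "k \<noteq> 0"
  shows "\<exists>a. a \<noteq> 0 \<and> D *v x = a *s rep_proj l"
proof -
  have "rep_proj l = k *s (D *v x)"
    using arg_cong[OF l(1), of "(*v) D"] by (simp add: plane_def D vec.scale)
  then have "D *v x = inverse k *s rep_proj l" using l(2) by (simp add: vector_smult_assoc)
  then show ?thesis using l(2) nonzero_imp_inverse_nonzero by blast
qed

text \<open>
  Deform the line spanned by \<open>e1, e2\<close> to the one spanned by \<open>e1 + t f1, e2 + t f2\<close>.  For a center
  outside the original line the back-projected plane depends continuously on \<open>t\<close>.  For a center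
  \<open>c i\<close> on it, the deformed line contains \<open>c i + t (\<alpha> i f1 + \<beta> i f2)\<close>, so the plane tends to the
  span of \<open>e1, e2\<close> and \<open>\<alpha> i f1 + \<beta> i f2\<close>, which is the given one.
\<close>

lemma closure_if_transversal_deformation:
  fixes C :: "'m::finite \<Rightarrow> complex ^ 4 ^ 3" and p :: "'m \<Rightarrow> 3 proj"
  defines "c \<equiv> \<lambda>i. rep_proj (center (C i))"
  assumes C: "\<And>i. pinhole_camera (C i)" and e: "indep2 e1 e2"
    and pe: "\<And>i. scalar_product (plane (C i) (p i)) e1 = 0" "\<And>i. scalar_product (plane (C i) (p i)) e2 = 0"
    and coord: "\<And>i. c i \<in> vec.span {e1, e2} \<Longrightarrow> c i = \<alpha> i *s e1 + \<beta> i *s e2"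
    and f: "\<And>i. c i \<in> vec.span {e1, e2} \<Longrightarrow> vol e1 e2 (\<alpha> i *s f1 + \<beta> i *s f2) \<noteq> 0"
      "\<And>i. c i \<in> vec.span {e1, e2} \<Longrightarrow> scalar_product (plane (C i) (p i)) (\<alpha> i *s f1 + \<beta> i *s f2) = 0"
  shows "p \<in> zariski closure_of joint_camera_image C"
proof -
  \<comment> \<open>The plane through \<open>c i\<close> and the deformed line; for a center on the original line, its
  covector vanishes at \<open>t = 0\<close> and is divided by \<open>t\<close>.\<close>
  define x where "x t i = (if c i \<in> vec.span {e1, e2}
    then (vol (c i) f1 e2 + vol (c i) e1 f2) + t *s vol (c i) f1 f2
    else vol (c i) (e1 + t *s f1) (e2 + t *s f2))" for t i
  have x_vol: "\<exists>k. k \<noteq> 0 \<and> vol (c i) (e1 + t *s f1) (e2 + t *s f2) = k *s x t i" if "t \<noteq> 0" for t i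
  proof (cases "c i \<in> vec.span {e1, e2}")
    case True
    have "vol (c i) e1 e2 = 0" using coord[OF True] by (simp add: vol_add vol_smult vol_alternating)
    then have "vol (c i) (e1 + t *s f1) (e2 + t *s f2) = t *s x t i"
      using True by (simp add: x_def vol_add vol_smult vec.scale_right_distrib algebra_simps)
    then show ?thesis using that by blast
  next
    case False
    then show ?thesis by (intro exI[of _ 1]) (simp add: x_def)
  qed
  have x0: "\<exists>k. k \<noteq> 0 \<and> plane (C i) (p i) = k *s x 0 i" "x 0 i \<noteq> 0" for i
  proof -
    \<comment> \<open>Besides \<open>e1, e2\<close>, the plane contains a third point \<open>y\<close>: \<open>\<alpha> i f1 + \<beta> i f2\<close> or \<open>c i\<close>.\<close>
    obtain y where y: "vol e1 e2 y \<noteq> 0" "scalar_product (plane (C i) (p i)) y = 0" "x 0 i = vol e1 e2 y \<or> x 0 i = - vol e1 e2 y"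
    proof (cases "c i \<in> vec.span {e1, e2}")
      case True
      then have "x 0 i = - vol e1 e2 (\<alpha> i *s f1 + \<beta> i *s f2)"
        by (simp add: x_def coord[OF True] vol_add vol_smult vol_alternating vol_swap(1)[of e1 e2] vol_swap(2)[of e1 f1 e2])
      then show ?thesis using that f True by blast
    next
      case False
      then have "x 0 i = vol e1 e2 (c i)"
        by (simp add: x_def vol_cycle[of e1 e2])
      moreover have "vol e1 e2 (c i) \<noteq> 0" using False e by (simp add: vol_nonzero_iff)
      ultimately show ?thesis using that plane_center[OF C] unfolding c_def by blast
    qed
    show "x 0 i \<noteq> 0" using y(1,3) by auto
    obtain k where k: "plane (C i) (p i) = k *s vol e1 e2 y"
      using vol_unique[OF y(1), of "plane (C i) (p i)"] pe[of i] y(2) by (auto simp: scalar_product_commute)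
    then have "k \<noteq> 0" using plane_nonzero[OF C, of i "p i"] by auto
    moreover have "plane (C i) (p i) = k *s x 0 i \<or> plane (C i) (p i) = (- k) *s x 0 i"
      using y(3) k by auto
    ultimately show "\<exists>k. k \<noteq> 0 \<and> plane (C i) (p i) = k *s x 0 i" by (metis neg_equal_0_iff_equal)
  qed
  have x_poly: "poly_fun (\<lambda>t. x t i $ k)" for i k
  proof (cases "c i \<in> vec.span {e1, e2}")
    case True
    then show ?thesis unfolding x_def by (simp only: if_True) (rule poly_fun_line)
  next
    case False
    then show ?thesis
      unfolding x_def by (simp only: if_False) (intro poly_fun_vol poly_fun_line poly_fun_const)
  qed
  have "\<forall>i. \<exists>D. \<forall>l. D *v (l v* C i) = l" using pinhole_camera_left_inverse[OF C] by blast
  then obtain D where D: "\<And>i l. D i *v (l v* C i) = l" by metis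
  have "finite ({0} \<union> (\<Union>i. {t. x t i = 0}))"
    using poly_vector_finite_zeros[OF x_poly x0(2)] by simp
  then have inf: "infinite (- ({0} \<union> (\<Union>i. {t. x t i = 0})))"
    using infinite_UNIV_char_0[where 'a = complex] by (metis finite_Un Compl_partition)
  have good: "\<exists>q\<in>zariski closure_of joint_camera_image C. homogeneous_coords (\<lambda>i. D i *v x t i) q"
    if t: "t \<notin> {0} \<union> (\<Union>i. {t. x t i = 0})" for t
  proof -
    let ?a = "e1 + t *s f1" and ?b = "e2 + t *s f2"
    have "t \<noteq> 0" and xt: "x t i \<noteq> 0" for i using t by auto
    have perp: "scalar_product (x t i) (c i) = 0 \<and> scalar_product (x t i) ?a = 0 \<and> scalar_product (x t i) ?b = 0" for i
    proof -
      obtain k where k: "k \<noteq> 0" "vol (c i) ?a ?b = k *s x t i" using x_vol[OF \<open>t \<noteq> 0\<close>] by blast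
      then show ?thesis using vol_orthogonal[of "c i" ?a ?b] by (simp add: scalar_product_smult)
    qed
    have vol_ab: "vol ?a ?b (c i) \<noteq> 0" for i
    proof -
      obtain k where k: "k \<noteq> 0" "vol (c i) ?a ?b = k *s x t i" using x_vol[OF \<open>t \<noteq> 0\<close>] by blast
      have "vol ?a ?b (c i) = vol (c i) ?a ?b" by (rule vol_cycle)
      then show ?thesis using k xt[of i] by simp
    qed
    have "\<forall>i. \<exists>l a. a \<noteq> 0 \<and> plane (C i) l = a *s x t i"
      using plane_surj[OF C xt] perp unfolding c_def by blast
    then obtain q a where q: "\<And>i. a i \<noteq> 0 \<and> plane (C i) (q i) = a i *s x t i" by metis
    have "q \<in> joint_camera_image C"
      unfolding joint_camera_image_iff[OF C]
      using vol_ab q perp by (intro exI[of _ ?a] exI[of _ ?b]) (simp add: vol_nonzero_iff scalar_product_smult c_def)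
    then have "q \<in> zariski closure_of joint_camera_image C"
      using closure_of_subset[of "joint_camera_image C" zariski] by (auto simp: topspace_zariski)
    moreover have "homogeneous_coords (\<lambda>i. D i *v x t i) q"
      unfolding homogeneous_coords_def using coordinates_of_plane[OF D] q by blast
    ultimately show ?thesis by blast
  qed
  show ?thesis
  proof (rule zariski_closure_curve[where x = "\<lambda>t i. D i *v x t i"])
    show "poly_fun (\<lambda>t. (D i *v x t i) $ j)" for i j by (rule poly_fun_matrix[OF x_poly])
    show "infinite {t. \<exists>q\<in>zariski closure_of joint_camera_image C. homogeneous_coords (\<lambda>i. D i *v x t i) q}"
      using inf by (rule infinite_super[rotated]) (use good in blast)
    show "homogeneous_coords (\<lambda>i. D i *v x 0 i) p"
      unfolding homogeneous_coords_def using coordinates_of_plane[OF D] x0(1) by blast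
  qed
qed

lemma indep2_exists_orthogonal:
  fixes h :: "complex ^ 'n"
  assumes "indep2 u v"
  shows "\<exists>w\<in>vec.span {u, v}. w \<noteq> 0 \<and> scalar_product h w = 0"
proof (cases "scalar_product h u = 0")
  case True
  then show ?thesis using indep2_nonzero(1)[OF assms] by (auto simp: vec.span_base)
next
  case False
  let ?w = "scalar_product h v *s u + (- scalar_product h u) *s v"
  have "?w \<noteq> 0" using assms False unfolding indep2_def by fastforce
  moreover have "scalar_product h ?w = 0" by (simp only: scalar_product_simps) simp
  moreover have "?w \<in> vec.span {u, v}" unfolding in_span_2 by blast
  ultimately show ?thesis by blast
qed

context skew_lines
begin

lemma vol_nonzero_if_in_W: "x \<in> W \<Longrightarrow> x \<noteq> 0 \<Longrightarrow> vol e1 e2 x \<noteq> 0"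
  using disjoint indep_e by (auto simp: vol_nonzero_iff)

text \<open>
  If the map \<open>\<phi>\<close> given by \<open>f1, f2\<close> kills a center \<open>c j\<close> on \<open>E\<close>, it has rank one and kills no
  other center.  Replace it by \<open>\<phi> + t \<psi>\<close>, where \<open>\<psi>\<close> maps \<open>c j\<close> to a vector \<open>w\<close> of \<open>W\<close> in the
  plane of the \<open>j\<close>-th camera, and let the planes of the other cameras on \<open>E\<close> follow this map.
  The resulting tuples are in the closure by the nondegenerate case, and they tend to \<open>p\<close>.
\<close>

lemma closure_if_degenerate_deformation:
  fixes C :: "'m::finite \<Rightarrow> complex ^ 4 ^ 3" and p :: "'m \<Rightarrow> 3 proj"
  defines "c \<equiv> \<lambda>i. rep_proj (center (C i))"
  assumes C: "\<And>i. pinhole_camera (C i)" and inj: "inj (\<lambda>i. center (C i))"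
    and pe: "\<And>i. scalar_product (plane (C i) (p i)) e1 = 0" "\<And>i. scalar_product (plane (C i) (p i)) e2 = 0"
    and coord: "\<And>i. c i \<in> E \<Longrightarrow> c i = \<alpha> i *s e1 + \<beta> i *s e2"
    and f: "f1 \<in> W" "f2 \<in> W" "\<not> (f1 = 0 \<and> f2 = 0)"
    and pf: "\<And>i. c i \<in> E \<Longrightarrow> scalar_product (plane (C i) (p i)) (\<alpha> i *s f1 + \<beta> i *s f2) = 0"
  shows "p \<in> zariski closure_of joint_camera_image C"
proof (cases "\<forall>i. c i \<in> E \<longrightarrow> \<alpha> i *s f1 + \<beta> i *s f2 \<noteq> 0")
  case True
  show ?thesis
  proof (rule closure_if_transversal_deformation[OF C indep_e pe, where \<alpha> = \<alpha> and \<beta> = \<beta>])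
    fix i assume "rep_proj (center (C i)) \<in> E"
    then have i: "c i \<in> E" by (simp add: c_def)
    show "rep_proj (center (C i)) = \<alpha> i *s e1 + \<beta> i *s e2" using coord[OF i] by (simp add: c_def)
    show "vol e1 e2 (\<alpha> i *s f1 + \<beta> i *s f2) \<noteq> 0"
      using True i by (intro vol_nonzero_if_in_W combination_in_W f) blast
    show "scalar_product (plane (C i) (p i)) (\<alpha> i *s f1 + \<beta> i *s f2) = 0" by (rule pf[OF i])
  qed
next
  case False
  then obtain j where j: "c j \<in> E" "\<alpha> j *s f1 + \<beta> j *s f2 = 0" by blast
  define \<phi> where "\<phi> i = \<alpha> i *s f1 + \<beta> i *s f2" for i
  have \<phi>W: "\<phi> i \<in> W" for i unfolding \<phi>_def by (intro combination_in_W f)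
  have \<phi>_nonzero: "\<phi> i \<noteq> 0" if i: "c i \<in> E" "i \<noteq> j" for i
  proof
    assume 0: "\<phi> i = 0"
    define d where "d = \<alpha> i * \<beta> j - \<alpha> j * \<beta> i"
    have "center (C i) \<noteq> center (C j)" using inj i(2) by (auto simp: inj_def)
    then have ij: "indep2 (c i) (c j)" unfolding c_def by (simp only: proj_neq_iff)
    have "d \<noteq> 0"
    proof
      assume "d = 0"
      then have "\<alpha> j *s c i + (- \<alpha> i) *s c j = 0" "\<beta> j *s c i + (- \<beta> i) *s c j = 0"
        unfolding coord[OF i(1)] coord[OF j(1)] by (simp_all add: d_def vec_eq_iff algebra_simps)
      then have "\<alpha> j = 0" "\<beta> j = 0" using ij unfolding indep2_def by blast+
      then have "c j = 0" using coord[OF j(1)] by simp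
      then show False by (simp add: c_def rep_proj_nonzero)
    qed
    moreover have "d *s f1 = \<beta> j *s \<phi> i - \<beta> i *s (\<alpha> j *s f1 + \<beta> j *s f2)"
      "d *s f2 = \<alpha> i *s (\<alpha> j *s f1 + \<beta> j *s f2) - \<alpha> j *s \<phi> i"
      by (simp_all add: d_def \<phi>_def vec_eq_iff algebra_simps)
    ultimately show False using f(3) 0 j(2) by simp
  qed
  obtain w where w: "w \<in> W" "w \<noteq> 0" "scalar_product (plane (C j) (p j)) w = 0"
    using indep2_exists_orthogonal[OF indep_w] by blast
  have "\<not> (\<alpha> j = 0 \<and> \<beta> j = 0)"
    using coord[OF j(1)] rep_proj_nonzero[of "center (C j)"] by (auto simp: c_def)
  \<comment> \<open>The map \<open>e1 \<mapsto> s1 w\<close>, \<open>e2 \<mapsto> s2 w\<close> sends \<open>c j\<close> to \<open>w\<close>.\<close>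
  then obtain s1 s2 where s: "\<alpha> j * s1 + \<beta> j * s2 = 1"
    by (metis add.left_neutral add.right_neutral mult_zero_right right_inverse)
  define \<psi> where "\<psi> t i = \<phi> i + t *s ((\<alpha> i * s1 + \<beta> i * s2) *s w)" for t i
  have \<psi>_eq: "\<psi> t i = \<alpha> i *s (f1 + (t * s1) *s w) + \<beta> i *s (f2 + (t * s2) *s w)" for t i
    by (simp add: \<psi>_def \<phi>_def vec_eq_iff algebra_simps)
  have \<psi>W: "\<psi> t i \<in> W" for t i
    unfolding \<psi>_def by (intro vec.span_add vec.span_scale \<phi>W w(1))
  have \<psi>j: "\<psi> t j = t *s w" for t using j(2) s by (simp add: \<psi>_def \<phi>_def)
  have \<psi>0: "\<psi> 0 i = \<phi> i" for i by (simp add: \<psi>_def)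
  have "\<forall>i. \<exists>D. \<forall>l. D *v (l v* C i) = l" using pinhole_camera_left_inverse[OF C] by blast
  then obtain D where D: "\<And>i l. D i *v (l v* C i) = l" by metis
  define K where "K = {i. c i \<in> E \<and> i \<noteq> j}"
  define x where "x t i = (if i \<in> K then D i *v vol e1 e2 (\<psi> t i) else rep_proj (p i))" for t i
  have \<psi>_poly: "poly_fun (\<lambda>t. \<psi> t i $ k)" for i k unfolding \<psi>_def by (rule poly_fun_line)
  have x_poly: "poly_fun (\<lambda>t. x t i $ k)" for i k
  proof (cases "i \<in> K")
    case True
    then show ?thesis
      unfolding x_def by (simp only: if_True) (intro poly_fun_matrix poly_fun_vol poly_fun_const \<psi>_poly)
  qed (simp add: x_def poly_fun_const)
  have "finite {t. \<psi> t i = 0}" if "i \<in> K" for i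
    using poly_vector_finite_zeros[OF \<psi>_poly, where s = 0] \<phi>_nonzero that by (simp add: \<psi>0 K_def)
  then have "finite ({0} \<union> (\<Union>i\<in>K. {t. \<psi> t i = 0}))" by simp
  then have inf: "infinite (- ({0} \<union> (\<Union>i\<in>K. {t. \<psi> t i = 0})))"
    using infinite_UNIV_char_0[where 'a = complex] by (metis finite_Un Compl_partition)
  have good: "\<exists>q\<in>zariski closure_of joint_camera_image C. homogeneous_coords (x t) q"
    if t: "t \<notin> {0} \<union> (\<Union>i\<in>K. {t. \<psi> t i = 0})" for t
  proof -
    have "t \<noteq> 0" and \<psi>_ne: "\<And>i. i \<in> K \<Longrightarrow> \<psi> t i \<noteq> 0" using t by auto
    have "\<exists>l a. a \<noteq> 0 \<and> plane (C i) l = a *s vol e1 e2 (\<psi> t i)" if "i \<in> K" for i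
    proof (rule plane_surj[OF C])
      show "vol e1 e2 (\<psi> t i) \<noteq> 0" using vol_nonzero_if_in_W \<psi>W \<psi>_ne that by blast
      have "c i \<in> E" using that by (simp add: K_def)
      then have "scalar_product (vol e1 e2 (\<psi> t i)) (c i) = 0"
        by (subst coord) (simp_all add: scalar_product_simps vol_orthogonal)
      then show "scalar_product (vol e1 e2 (\<psi> t i)) (rep_proj (center (C i))) = 0" by (simp add: c_def)
    qed
    then have "\<forall>i\<in>K. \<exists>l a. a \<noteq> 0 \<and> plane (C i) l = a *s vol e1 e2 (\<psi> t i)" by blast
    then obtain l a where l: "\<And>i. i \<in> K \<Longrightarrow> a i \<noteq> 0 \<and> plane (C i) (l i) = a i *s vol e1 e2 (\<psi> t i)"
      by metis
    define q where "q i = (if i \<in> K then l i else p i)" for i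
    have qK: "a i \<noteq> 0" "plane (C i) (q i) = a i *s vol e1 e2 (\<psi> t i)" if "i \<in> K" for i
      using l that by (simp_all add: q_def)
    have q_other: "q i = p i" if "i \<notin> K" for i using that by (simp add: q_def)
    have "q \<in> zariski closure_of joint_camera_image C"
    proof (rule closure_if_transversal_deformation[OF C indep_e, where \<alpha> = \<alpha> and \<beta> = \<beta>])
      have "scalar_product (plane (C i) (q i)) e1 = 0 \<and> scalar_product (plane (C i) (q i)) e2 = 0" for i
      proof (cases "i \<in> K")
        case True
        then show ?thesis by (simp add: qK(2) scalar_product_smult vol_orthogonal)
      qed (simp add: q_other pe)
      then show "scalar_product (plane (C i) (q i)) e1 = 0" "scalar_product (plane (C i) (q i)) e2 = 0" for i
        by blast+
      fix i assume "rep_proj (center (C i)) \<in> E"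
      then have i: "c i \<in> E" by (simp add: c_def)
      show "rep_proj (center (C i)) = \<alpha> i *s e1 + \<beta> i *s e2" using coord[OF i] by (simp add: c_def)
      have "\<psi> t i \<noteq> 0"
        using \<psi>_ne[of i] i \<psi>j[of t] \<open>t \<noteq> 0\<close> w(2) by (cases "i = j") (auto simp: K_def)
      then have "vol e1 e2 (\<psi> t i) \<noteq> 0" by (intro vol_nonzero_if_in_W \<psi>W)
      then show "vol e1 e2 (\<alpha> i *s (f1 + (t * s1) *s w) + \<beta> i *s (f2 + (t * s2) *s w)) \<noteq> 0"
        unfolding \<psi>_eq .
      have "scalar_product (plane (C i) (q i)) (\<psi> t i) = 0"
      proof (cases "i = j")
        case True
        then show ?thesis using w(3) q_other[of j] by (simp add: K_def \<psi>j scalar_product_smult)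
      next
        case False
        then have "i \<in> K" using i by (simp add: K_def)
        then show ?thesis by (simp add: qK(2) scalar_product_smult vol_orthogonal)
      qed
      then show "scalar_product (plane (C i) (q i)) (\<alpha> i *s (f1 + (t * s1) *s w) + \<beta> i *s (f2 + (t * s2) *s w)) = 0"
        unfolding \<psi>_eq .
    qed
    moreover have "homogeneous_coords (x t) q"
      unfolding homogeneous_coords_def
    proof
      fix i show "\<exists>a. a \<noteq> 0 \<and> x t i = a *s rep_proj (q i)"
      proof (cases "i \<in> K")
        case True
        then show ?thesis using coordinates_of_plane[OF D qK(2,1)] by (simp add: x_def)
      next
        case False
        then show ?thesis by (intro exI[of _ 1]) (simp add: x_def q_other)
      qed
    qed
    ultimately show ?thesis by blast
  qed
  show ?thesis
  proof (rule zariski_closure_curve[where x = x])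
    show "poly_fun (\<lambda>t. x t i $ j)" for i j by (rule x_poly)
    show "infinite {t. \<exists>q\<in>zariski closure_of joint_camera_image C. homogeneous_coords (x t) q}"
      using inf by (rule infinite_super[rotated]) (use good in blast)
    show "homogeneous_coords (x 0) p"
      unfolding homogeneous_coords_def
    proof
      fix i show "\<exists>a. a \<noteq> 0 \<and> x 0 i = a *s rep_proj (p i)"
      proof (cases "i \<in> K")
        case True
        then have v: "vol e1 e2 (\<phi> i) \<noteq> 0"
          using \<phi>_nonzero by (intro vol_nonzero_if_in_W \<phi>W) (auto simp: K_def)
        obtain k where k: "plane (C i) (p i) = k *s vol e1 e2 (\<phi> i)"
          using vol_unique[OF v, of "plane (C i) (p i)"] pe[of i] pf[of i] True
          by (auto simp: scalar_product_commute K_def \<phi>_def)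
        then have "k \<noteq> 0" using plane_nonzero[OF C, of i "p i"] by auto
        then show ?thesis
          using coordinates_of_plane[OF D k] True by (auto simp: x_def \<psi>0)
      next
        case False
        then show ?thesis by (intro exI[of _ 1]) (simp add: x_def)
      qed
    qed
  qed
qed

end

section \<open>The two inclusions\<close>

lemma rank_M_matrix: "rank (M_matrix C l) = vec.dim (range (\<lambda>i. plane (C i) (l i)))"
proof -
  have "column i (M_matrix C l) = plane (C i) (l i)" for i
    by (simp add: vec_eq_iff column_def M_matrix_def plane_def)
  then have "columns (M_matrix C l) = range (\<lambda>i. plane (C i) (l i))"
    by (auto simp: columns_def)
  then show ?thesis by (simp add: rank_eq_dim_columns)
qed

lemma multihomogeneous_plane:
  fixes C :: "'m::finite \<Rightarrow> complex ^ 4 ^ 3"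
  shows "multihomogeneous (\<lambda>i'. if i' = i then 1 else 0) (\<lambda>x. (x i v* C i) $ k)"
proof -
  have "(x i v* C i) $ k = (\<Sum>l\<in>UNIV. C i $ l $ k * x i $ l)" for x
    by (simp add: vector_matrix_mult_def mult.commute)
  then show ?thesis
    by (simp only:) (intro multihomogeneous_sum multihomogeneous_cmult multihomogeneous_coordinate)
qed

lemma multihomogeneous_plane_product:
  fixes C :: "'m::finite \<Rightarrow> complex ^ 4 ^ 3"
  shows "multihomogeneous (\<lambda>i'. if i' = i then 1 else 0) (\<lambda>x. a * scalar_product (x i v* C i) w)"
proof -
  have "multihomogeneous (\<lambda>i'. if i' = i then 1 else 0) (\<lambda>x. a * (\<Sum>k\<in>UNIV. w $ k * (x i v* C i) $ k))"
    by (intro multihomogeneous_cmult multihomogeneous_sum multihomogeneous_plane)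
  then show ?thesis by (simp add: scalar_product_def mult.commute)
qed

text \<open>
  On the image, the planes share a line, and a line contains a point of every further plane \<open>v\<close>.
  For each \<open>v\<close> this is a closed condition, and for all \<open>v\<close> together it bounds the rank.
\<close>

lemma rank_le_2_if_in_line_multiview_variety:
  fixes C :: "'m::finite \<Rightarrow> complex ^ 4 ^ 3"
  assumes C: "\<And>i. pinhole_camera (C i)" and p: "p \<in> line_multiview_variety C"
  shows "rank (M_matrix C p) \<le> 2"
  unfolding rank_M_matrix
proof (rule dim_le_2_if_orthogonal)
  fix v :: "complex ^ 4"
  \<comment> \<open>The value \<open>None\<close> adds the constant covector \<open>v\<close> to the family of planes.\<close>
  define r where "r s x = (case s of None \<Rightarrow> v | Some i \<Rightarrow> x i v* C i)" for s and x :: "'m \<Rightarrow> complex ^ 3"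
  define d where "d s = (\<lambda>i'. case s of None \<Rightarrow> 0 :: nat | Some i \<Rightarrow> (if i' = i then 1 else 0))" for s :: "'m option"
  have "\<exists>y. y \<noteq> 0 \<and> (\<forall>s\<in>UNIV. scalar_product (r s (\<lambda>i. rep_proj (p i))) y = 0)"
  proof (rule common_orthogonal_closed[where d = d and Q = "joint_camera_image C"])
    show "multihomogeneous (d s) (\<lambda>x. r s x $ k)" for s k
      by (cases s) (simp_all add: d_def r_def multihomogeneous_const multihomogeneous_plane)
    show "p \<in> zariski closure_of joint_camera_image C" using p by (simp add: line_multiview_variety_def)
    fix q assume "q \<in> joint_camera_image C"
    then obtain u v' where uv: "indep2 u v'" "\<And>i. scalar_product (plane (C i) (q i)) u = 0"
      "\<And>i. scalar_product (plane (C i) (q i)) v' = 0"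
      unfolding joint_camera_image_iff[OF C] by blast
    obtain y where y: "y \<in> vec.span {u, v'}" "y \<noteq> 0" "scalar_product v y = 0"
      using indep2_exists_orthogonal[OF uv(1)] by blast
    have "scalar_product (plane (C i) (q i)) y = 0" for i
      using orthogonal_span_iff[of "{u, v'}" "plane (C i) (q i)"] uv(2,3) y(1) by blast
    then have "scalar_product (r s (\<lambda>i. rep_proj (q i))) y = 0" for s
      using y(3) by (cases s) (simp_all add: r_def plane_def)
    then show "\<exists>y. y \<noteq> 0 \<and> (\<forall>s\<in>UNIV. scalar_product (r s (\<lambda>i. rep_proj (q i))) y = 0)"
      using y(2) by blast
  qed
  then obtain y where y: "y \<noteq> 0" "\<And>s. scalar_product (r s (\<lambda>i. rep_proj (p i))) y = 0" by blast
  have "scalar_product v y = 0" using y(2)[of None] by (simp add: r_def)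
  moreover have "scalar_product (plane (C i) (p i)) y = 0" for i
    using y(2)[of "Some i"] by (simp add: r_def plane_def)
  ultimately show "\<exists>x. x \<noteq> 0 \<and> (\<forall>s\<in>insert v (range (\<lambda>i. plane (C i) (p i))). scalar_product s x = 0)"
    using y(1) by blast
qed

lemma conj_complement_skew_lines:
  assumes "indep2 e1 e2"
  shows "\<exists>w1 w2. skew_lines e1 e2 w1 w2 \<and> conj_complement (vec.span {e1, e2}) = vec.span {w1, w2}"
proof -
  obtain w1 w2 where w: "indep2 w1 w2" "conj_complement (vec.span {e1, e2}) = vec.span {w1, w2}"
    "\<forall>x. \<exists>e\<in>vec.span {e1, e2}. \<exists>w\<in>vec.span {w1, w2}. x = e + w"
    using conj_complement_span[OF assms] by blast
  have "skew_lines e1 e2 w1 w2"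
  proof
    fix x assume "x \<in> vec.span {e1, e2}" "x \<in> vec.span {w1, w2}"
    then show "x = 0" using conj_complement_disjoint w(2) by simp
  qed (use assms w in simp_all)
  then show ?thesis using w(2) by blast
qed

context skew_lines
begin

text \<open>
  The line spanned by \<open>c\<close> and a point of \<open>W\<close> in the plane of \<open>h\<close> lies in this plane, as does the
  line spanned by \<open>u, v\<close>; hence the two lines meet.
\<close>

lemma image_line_transversal:
  assumes uv: "indep2 u v" and c: "c \<in> E" "c \<noteq> 0" "c \<notin> vec.span {u, v}"
    and h: "h \<noteq> 0" "scalar_product h c = 0" "scalar_product h u = 0" "scalar_product h v = 0"
  shows "\<exists>x a w. x \<noteq> 0 \<and> x \<in> vec.span {u, v} \<and> x = a *s c + w \<and> w \<in> W \<and> scalar_product h w = 0"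
proof -
  obtain w where w: "w \<in> W" "w \<noteq> 0" "scalar_product h w = 0"
    using indep2_exists_orthogonal[OF indep_w] by blast
  have "w \<in> vec.span {c, u, v}"
  proof (rule ccontr)
    assume "w \<notin> vec.span {c, u, v}"
    then have "vec.dim {w, c, u, v} = CARD(4)"
      using vec.dim_insert[of w "{c, u, v}"] vec.dim_insert[of c "{u, v}"] c(3) dim_2_iff[of u v] uv by simp
    then have "vec.span {w, c, u, v} = UNIV"
      using vec.dim_eq_full[of "{w, c, u, v}"] by (simp add: vec.dimension_def card_cart_basis)
    moreover have "\<forall>z\<in>vec.span {w, c, u, v}. scalar_product h z = 0"
      unfolding orthogonal_span_iff using w(3) h by simp
    ultimately have "scalar_product h z = 0" for z by simp
    then show False using scalar_product_all_zero h(1) by blast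
  qed
  then obtain k where k: "w - k *s c \<in> vec.span {u, v}" by (auto simp: vec.span_breakdown_eq[of w c])
  have "w - k *s c \<noteq> 0"
  proof
    assume "w - k *s c = 0"
    then have "w = k *s c" by simp
    then have "w \<in> E" using c(1) by (simp add: vec.span_scale)
    then show False using disjoint w by blast
  qed
  moreover have "w - k *s c = (- k) *s c + w" by simp
  ultimately show ?thesis using k w by blast
qed

end

lemma center_span_coordinates:
  assumes "center_span C I = proj_of (vec.span {e1, e2})"
  shows "\<exists>\<alpha> \<beta>. \<forall>i\<in>I. rep_proj (center (C i)) = \<alpha> i *s e1 + \<beta> i *s e2"
proof -
  have "rep_proj (center (C i)) \<in> vec.span {e1, e2}" if "i \<in> I" for i
  proof -
    have "center (C i) \<in> center_span C I"
      using that by (auto simp: center_span_def proj_span_def intro: vec.span_base)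
    then show ?thesis unfolding assms by (simp add: proj_of_def)
  qed
  then have "\<forall>i\<in>I. \<exists>a b. rep_proj (center (C i)) = a *s e1 + b *s e2" unfolding in_span_2 by blast
  then show ?thesis by metis
qed

text \<open>
  A compatible map exists for each point of the image, hence for each point of the closure; its
  pencil of graphs shows that the common transversals have positive dimension.
\<close>

lemma Y_variety_if_in_line_multiview_variety:
  fixes C :: "'m::finite \<Rightarrow> complex ^ 4 ^ 3"
  assumes C: "\<And>i. pinhole_camera (C i)" and p: "p \<in> line_multiview_variety C"
  shows "p \<in> Y_variety C"
  unfolding Y_variety_def
proof
  fix I assume I: "I \<in> {I. card I \<ge> 2 \<and> is_line (center_span C I)}"
  then have "center_span C I \<in> grass" by (simp add: grass_def)
  then obtain e1 e2 where e: "indep2 e1 e2" "center_span C I = proj_of (vec.span {e1, e2})"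
    using grass_iff by blast
  obtain w1 w2 where sk: "skew_lines e1 e2 w1 w2" and W: "conj_complement (vec.span {e1, e2}) = vec.span {w1, w2}"
    using conj_complement_skew_lines[OF e(1)] by blast
  interpret skew_lines e1 e2 w1 w2 by (rule sk)
  let ?c = "\<lambda>i. rep_proj (center (C i))"
  obtain \<alpha> \<beta> where c: "\<And>i. i \<in> I \<Longrightarrow> ?c i = \<alpha> i *s e1 + \<beta> i *s e2"
    using center_span_coordinates[OF e(2)] by blast
  have "I \<noteq> {}" using I by auto
  then obtain i0 where i0: "i0 \<in> I" by blast
  \<comment> \<open>The equation \<open>h\<^sub>i \<phi>(c\<^sub>i) = 0\<close>, written in the four coefficients of \<open>\<phi>\<close> with respect to the
  bases \<open>e1, e2\<close> and \<open>w1, w2\<close>.\<close>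
  define r where "r i x = ((\<chi> k. if k = 1 then \<alpha> i * scalar_product (x i v* C i) w1
    else if k = 2 then \<alpha> i * scalar_product (x i v* C i) w2
    else if k = 3 then \<beta> i * scalar_product (x i v* C i) w1
    else \<beta> i * scalar_product (x i v* C i) w2) :: complex ^ 4)"
    for i and x :: "'m \<Rightarrow> complex ^ 3"
  have r: "scalar_product (r i (\<lambda>i. rep_proj (q i))) y =
      scalar_product (plane (C i) (q i)) (\<alpha> i *s (y $ 1 *s w1 + y $ 2 *s w2) + \<beta> i *s (y $ 3 *s w1 + y $ 4 *s w2))"
    for i q y
    unfolding scalar_product_def[of "r i _"] sum_4
    by (simp add: r_def plane_def scalar_product_simps algebra_simps)
  have "\<exists>y. y \<noteq> 0 \<and> (\<forall>i\<in>I. scalar_product (r i (\<lambda>i. rep_proj (p i))) y = 0)"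
  proof (rule common_orthogonal_closed[where d = "\<lambda>i i'. if i' = i then 1 else 0" and Q = "joint_camera_image C"])
    show "multihomogeneous (\<lambda>i'. if i' = i then 1 else 0) (\<lambda>x. r i x $ k)" for i k
      by (cases "k = 1"; cases "k = 2"; cases "k = 3") (simp_all add: r_def multihomogeneous_plane_product)
    show "p \<in> zariski closure_of joint_camera_image C" using p by (simp add: line_multiview_variety_def)
    fix q assume "q \<in> joint_camera_image C"
    then obtain u v where uv: "indep2 u v" "\<And>i. ?c i \<notin> vec.span {u, v}"
      "\<And>i. scalar_product (plane (C i) (q i)) u = 0" "\<And>i. scalar_product (plane (C i) (q i)) v = 0"
      unfolding joint_camera_image_iff[OF C] by blast
    have "\<exists>f1\<in>W. \<exists>f2\<in>W. \<not> (f1 = 0 \<and> f2 = 0) \<and>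
      (\<forall>i\<in>I. scalar_product (plane (C i) (q i)) (\<alpha> i *s f1 + \<beta> i *s f2) = 0)"
    proof (cases "vec.span {u, v} = W")
      case True
      have "\<forall>z\<in>vec.span {u, v}. scalar_product (plane (C i) (q i)) z = 0" for i
        unfolding orthogonal_span_iff using uv(3,4) by simp
      then have "scalar_product (plane (C i) (q i)) w1 = 0" for i
        unfolding True by (simp add: vec.span_base)
      then show ?thesis
        using indep2_nonzero(1)[OF indep_w]
        by (intro bexI[of _ w1] bexI[of _ 0]) (auto simp: scalar_product_simps vec.span_base vec.span_zero)
    next
      case False
      show ?thesis
      proof (rule third_transversal[OF uv(1) _ False, where c = ?c])
        show "vec.span {u, v} \<noteq> E" using uv(2)[of i0] c[OF i0] e_in_E by metis
        show "?c i = \<alpha> i *s e1 + \<beta> i *s e2" if "i \<in> I" for i by (rule c[OF that])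
        show "\<exists>x a w. x \<noteq> 0 \<and> x \<in> vec.span {u, v} \<and> x = a *s ?c i + w \<and> w \<in> W \<and>
            scalar_product (plane (C i) (q i)) w = 0" if "i \<in> I" for i
        proof -
          have "?c i \<in> E" by (subst c[OF that]) (rule e_in_E)
          then show ?thesis
            by (rule image_line_transversal[OF uv(1) _ rep_proj_nonzero uv(2) plane_nonzero[OF C] plane_center[OF C] uv(3,4)])
        qed
      qed
    qed
    then obtain f1 f2 where f: "f1 \<in> W" "f2 \<in> W" "\<not> (f1 = 0 \<and> f2 = 0)"
      "\<And>i. i \<in> I \<Longrightarrow> scalar_product (plane (C i) (q i)) (\<alpha> i *s f1 + \<beta> i *s f2) = 0" by blast
    obtain a1 a2 where f1: "f1 = a1 *s w1 + a2 *s w2" using f(1) unfolding in_span_2 by blast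
    obtain b1 b2 where f2: "f2 = b1 *s w1 + b2 *s w2" using f(2) unfolding in_span_2 by blast
    define y :: "complex ^ 4" where "y = (\<chi> k. if k = 1 then a1 else if k = 2 then a2 else if k = 3 then b1 else b2)"
    have y: "y $ 1 = a1" "y $ 2 = a2" "y $ 3 = b1" "y $ 4 = b2" by (simp_all add: y_def)
    have "y \<noteq> 0" using f(3) y unfolding f1 f2 by auto
    moreover have "scalar_product (r i (\<lambda>i. rep_proj (q i))) y = 0" if "i \<in> I" for i
      unfolding r y using f(4)[OF that] unfolding f1 f2 .
    ultimately show "\<exists>y. y \<noteq> 0 \<and> (\<forall>i\<in>I. scalar_product (r i (\<lambda>i. rep_proj (q i))) y = 0)" by blast
  qed
  then obtain y where y: "y \<noteq> 0" "\<And>i. i \<in> I \<Longrightarrow> scalar_product (r i (\<lambda>i. rep_proj (p i))) y = 0" by blast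
  define f1 f2 where "f1 = y $ 1 *s w1 + y $ 2 *s w2" and "f2 = y $ 3 *s w1 + y $ 4 *s w2"
  have f: "f1 \<in> W" "f2 \<in> W" unfolding f1_def f2_def in_span_2 by blast+
  have f_ne: "\<not> (f1 = 0 \<and> f2 = 0)"
  proof
    assume "f1 = 0 \<and> f2 = 0"
    then have "y $ 1 = 0 \<and> y $ 2 = 0" "y $ 3 = 0 \<and> y $ 4 = 0"
      using indep_w unfolding f1_def f2_def indep2_def by blast+
    then show False using y(1) by (simp add: vec_eq_iff forall_4)
  qed
  let ?X = "\<Inter>i\<in>I. Omega C I i (p i)"
  have "?X \<subseteq> grass" using i0 by (auto simp: Omega_def)
  moreover have "proj_of (vec.span {e1 + t *s f1, e2 + t *s f2}) \<in> ?X" for t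
  proof
    fix i assume i: "i \<in> I"
    let ?a = "e1 + t *s f1" and ?b = "e2 + t *s f2"
    let ?w = "t *s (\<alpha> i *s f1 + \<beta> i *s f2)"
    have ind: "indep2 ?a ?b" by (intro graph_indep vec.span_scale f)
    have eq: "\<alpha> i *s ?a + \<beta> i *s ?b = 1 *s ?c i + ?w"
      unfolding c[OF i] by (simp add: vec.scale_right_distrib vector_smult_assoc mult.commute algebra_simps)
    have "\<alpha> i *s ?a + \<beta> i *s ?b \<noteq> 0"
    proof
      assume "\<alpha> i *s ?a + \<beta> i *s ?b = 0"
      then have "\<alpha> i = 0 \<and> \<beta> i = 0" using ind unfolding indep2_def by blast
      then show False using c[OF i] rep_proj_nonzero[of "center (C i)"] by simp
    qed
    moreover have "\<alpha> i *s ?a + \<beta> i *s ?b \<in> vec.span {?a, ?b}" unfolding in_span_2 by blast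
    moreover have "?w \<in> W" by (intro vec.span_scale combination_in_W f)
    moreover have "scalar_product (plane (C i) (p i)) ?w = 0"
      using y(2)[OF i] unfolding r f1_def[symmetric] f2_def[symmetric] scalar_product_smult(2) by simp
    ultimately show "proj_of (vec.span {?a, ?b}) \<in> Omega C I i (p i)"
      unfolding in_Omega_iff[OF e(2) vec.subspace_span ind] W using eq by blast
  qed
  ultimately have "krull_dim (subtopology grass_zariski ?X) \<ge> 1"
    by (rule graph_pencil[OF f f_ne])
  then show "p \<in> Y_set C I" by (simp add: Y_set_def)
qed

text \<open>
  The condition of \<open>Y_variety\<close> enters through the set \<open>J\<close> of cameras whose centers lie on a
  line \<open>E\<close> common to all planes: positive dimension forces a transversal other than \<open>E\<close> and
  \<open>W\<close>, and thus a map along which \<open>E\<close> can be deformed.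
\<close>

lemma in_line_multiview_variety_if:
  fixes C :: "'m::finite \<Rightarrow> complex ^ 4 ^ 3"
  assumes C: "\<And>i. pinhole_camera (C i)" and inj: "inj (\<lambda>i. center (C i))"
    and rank: "rank (M_matrix C p) \<le> 2" and Y: "p \<in> Y_variety C"
  shows "p \<in> line_multiview_variety C"
proof -
  let ?c = "\<lambda>i. rep_proj (center (C i))"
  obtain e1 e2 where e: "indep2 e1 e2"
    and pe: "\<And>i. scalar_product (plane (C i) (p i)) e1 = 0" "\<And>i. scalar_product (plane (C i) (p i)) e2 = 0"
    using dim_le_2_imp_orthogonal_pair[OF rank[unfolded rank_M_matrix]] by blast
  obtain w1 w2 where sk: "skew_lines e1 e2 w1 w2" and W: "conj_complement (vec.span {e1, e2}) = vec.span {w1, w2}"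
    using conj_complement_skew_lines[OF e] by blast
  interpret skew_lines e1 e2 w1 w2 by (rule sk)
  define J where "J = {i. ?c i \<in> E}"
  have "\<forall>i\<in>J. \<exists>a b. ?c i = a *s e1 + b *s e2" unfolding J_def in_span_2 by blast
  then obtain \<alpha> \<beta> where c: "\<And>i. i \<in> J \<Longrightarrow> ?c i = \<alpha> i *s e1 + \<beta> i *s e2" by metis
  have "\<exists>f1\<in>W. \<exists>f2\<in>W. \<not> (f1 = 0 \<and> f2 = 0) \<and>
    (\<forall>i\<in>J. scalar_product (plane (C i) (p i)) (\<alpha> i *s f1 + \<beta> i *s f2) = 0)"
  \<comment> \<open>With at most one equation on the map, a nonzero solution is written down directly.\<close>
  proof (cases "card J \<ge> 2")
    case True
    then obtain i j where ij: "i \<in> J" "j \<in> J" "i \<noteq> j"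
      using card_le_Suc0_iff_eq[of J] by (auto simp: not_less_eq_eq numeral_2_eq_2)
    have "center (C i) \<noteq> center (C j)" using inj ij(3) by (auto simp: inj_def)
    then have ind: "indep2 (?c i) (?c j)" by (simp only: proj_neq_iff)
    have span: "vec.span (?c ` J) = E"
    proof
      show "vec.span (?c ` J) \<subseteq> E" by (rule vec.span_minimal) (auto simp: J_def)
      have "E = vec.span {?c i, ?c j}"
        using span_pair_eq[OF e ind] ij(1,2) by (simp add: J_def)
      also have "\<dots> \<subseteq> vec.span (?c ` J)" by (rule vec.span_mono) (use ij in blast)
      finally show "E \<subseteq> vec.span (?c ` J)" .
    qed
    have cs: "center_span C J = proj_of E"
      unfolding center_span_def proj_span_eq image_image span ..
    then have "is_line (center_span C J)" using e grass_iff[of "center_span C J"] by (auto simp: grass_def)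
    then have "p \<in> Y_set C J" using Y True unfolding Y_variety_def by blast
    then have dim: "krull_dim (subtopology grass_zariski (\<Inter>i\<in>J. Omega C J i (p i))) \<ge> 1"
      by (simp add: Y_set_def)
    let ?X = "\<Inter>i\<in>J. Omega C J i (p i)"
    have X: "?X \<subseteq> grass" using ij(1) by (auto simp: Omega_def)
    then have "\<not> ?X \<subseteq> {proj_of E, proj_of W}"
      using not_krull_dim_ge_1_if_two_lines dim by blast
    then obtain T where T: "T \<in> ?X" "T \<noteq> proj_of E" "T \<noteq> proj_of W" by blast
    then obtain u v where uv: "indep2 u v" "T = proj_of (vec.span {u, v})" using X grass_iff by blast
    show ?thesis
    proof (rule third_transversal[OF uv(1), where c = ?c])
      show "vec.span {u, v} \<noteq> E" "vec.span {u, v} \<noteq> W" using T uv(2) by auto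
      show "?c i = \<alpha> i *s e1 + \<beta> i *s e2" if "i \<in> J" for i by (rule c[OF that])
      show "\<exists>x a w. x \<noteq> 0 \<and> x \<in> vec.span {u, v} \<and> x = a *s ?c i + w \<and> w \<in> W \<and>
          scalar_product (plane (C i) (p i)) w = 0" if "i \<in> J" for i
      proof -
        have "proj_of (vec.span {u, v}) \<in> Omega C J i (p i)" using T(1) that uv(2) by blast
        then show ?thesis unfolding in_Omega_iff[OF cs vec.subspace_span uv(1)] W .
      qed
    qed
  next
    case False
    show ?thesis
    proof (cases "J = {}")
      case True
      then show ?thesis using indep2_nonzero(1)[OF indep_w]
        by (intro bexI[of _ w1] bexI[of _ 0]) (auto simp: vec.span_base vec.span_zero)
    next
      case False
      then obtain j where "j \<in> J" by blast
      then have J: "J = {j}" using \<open>\<not> card J \<ge> 2\<close> card_le_Suc0_iff_eq[of J] by auto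
      obtain w where w: "w \<in> W" "w \<noteq> 0" "scalar_product (plane (C j) (p j)) w = 0"
        using indep2_exists_orthogonal[OF indep_w] by blast
      then show ?thesis
        by (intro bexI[of _ w]) (auto simp: J scalar_product_simps)
    qed
  qed
  then obtain f1 f2 where f: "f1 \<in> W" "f2 \<in> W" "\<not> (f1 = 0 \<and> f2 = 0)"
    "\<And>i. i \<in> J \<Longrightarrow> scalar_product (plane (C i) (p i)) (\<alpha> i *s f1 + \<beta> i *s f2) = 0" by blast
  have "p \<in> zariski closure_of joint_camera_image C"
  proof (rule closure_if_degenerate_deformation[OF C inj pe _ f(1-3), where \<alpha> = \<alpha> and \<beta> = \<beta>])
    fix i assume "?c i \<in> E"
    then have "i \<in> J" by (simp add: J_def)
    then show "?c i = \<alpha> i *s e1 + \<beta> i *s e2" "scalar_product (plane (C i) (p i)) (\<alpha> i *s f1 + \<beta> i *s f2) = 0"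
      by (rule c, rule f(4))
  qed
  then show ?thesis by (simp add: line_multiview_variety_def)
qed

theorem theorem2p6:
  fixes C :: "'m::finite \<Rightarrow> complex ^ 4 ^ 3"
  assumes "CARD('m) \<ge> 2"
    and "\<And>i. pinhole_camera (C i)"
    and "inj (\<lambda>i. center (C i))"
  shows "line_multiview_variety C = {l. rank (M_matrix C l) \<le> 2} \<inter> Y_variety C"
  using rank_le_2_if_in_line_multiview_variety[where C = C, OF assms(2)]
    Y_variety_if_in_line_multiview_variety[where C = C, OF assms(2)]
    in_line_multiview_variety_if[where C = C, OF assms(2,3)] by blast

end
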